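(* Let $\Omega\subset\mathbb{R}$ be a compact interval, let $T:\Omega\to\Omega$ be a map of class $V$ with $k\ge2$ inverse branches, and let $p\in[1,\infty)$. For every potential $\varphi\in\operatorname{BV}_p(\Omega)$ such that $$\operatorname{BV}_p(\varphi)\le\frac23\log\Big(1+\frac{(k^{\frac1p}-1)^2}{16\,k^{\frac1p}(k^{\frac1p}+1)}\Big),$$ the transfer operator $\mathrm{L}_\varphi$ acting on $\operatorname{BV}_p(\Omega)$ has a spectral gap.
   Context: A map $T$ of a compact interval $\Omega$ is of class $V$ if there are $k$ maps $b_1,\dots,b_k:\Omega\to\Omega$ ("inverse branches") such that: (1) each $b_j$ is monotonic from $\Omega$ to an interval $I_j\subset\Omega$; (2) for all $x\in\Omega$ except possibly countably many, $T^{-1}(x)=\{b_1(x),\dots,b_k(x)\}$; (3) the intervals $I_j$ have disjoint interiors. For such a map (with its inverse branches), the transfer operator of potential $\varphi$ is $$\mathrm{L}_\varphi f(x)=\frac1k\sum_{j=1}^k e^{\varphi(b_j(x))}f(b_j(x)).$$ The total $p$-variation of $f:\Omega\to\mathbb{R}$ is $\operatorname{BV}_p(f)=\sup\big(\sum_{j=1}^n|f(x_j)-f(x_{j-1})|^p\big)^{1/p}$, the supremum being over all finite sequences $x_0<x_1<\dots<x_n$ in $\Omega$. $\operatorname{BV}_p(\Omega)$ is the Banach space of functions $f$ with $\operatorname{BV}_p(f)<\infty$, endowed with the norm $\lVert f\rVert_{\operatorname{BV}_p}=\lVert f\rVert_\infty+\operatorname{BV}_p(f)$. A bounded linear operator $\mathrm{L}$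 on a Banach space $\mathcal{X}$ has a spectral gap if it has an eigenvalue $\lambda>0$ with an eigenvector $u_0$, and there are a closed subspace $G\subset\mathcal{X}$ with $\langle u_0\rangle\oplus G=\mathcal{X}$ and $\mathrm{L}(G)\subset G$, and numbers $C>0$, $\delta\in(0,1)$, such that $\lVert (\mathrm{L}|_G)^n\rVert\le C\lambda^n(1-\delta)^n$ for all $n\in\mathbb{N}$. *)

theory Defs
  imports "HOL-Analysis.Analysis" "HOL-Library.Function_Algebras"
begin

section \<open>Real functions as a vector space\<close>

instantiation "fun" :: (type, real_vector) real_vector
begin

definition scaleR_fun :: "real \<Rightarrow> ('a \<Rightarrow> 'b) \<Rightarrow> 'a \<Rightarrow> 'b"
  where "scaleR_fun c f = (\<lambda>x. c *\<^sub>R f x)"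

instance
  by standard (simp_all add: scaleR_fun_def fun_eq_iff scaleR_add_right scaleR_add_left)

end

section \<open>Banach spaces with explicit carrier, spectral gap\<close>

text \<open>The spaces considered depend on parameters of the statement, hence are not types: a normed
  space is a linear subspace \<open>X\<close> of an ambient real vector space with a function \<open>N\<close> whose values
  on \<open>X\<close> are the norm. The distance is cut off outside \<open>X\<close> because the library's
  abstract metric spaces ask for nonnegativity and symmetry on the whole type.\<close>

definition norm_dist :: "'v::real_vector set \<Rightarrow> ('v \<Rightarrow> real) \<Rightarrow> 'v \<Rightarrow> 'v \<Rightarrow> real"
  where "norm_dist X N f g = (if f \<in> X \<and> g \<in> X then N (f - g) else 0)"

definition normed_space_on :: "'v::real_vector set \<Rightarrow> ('v \<Rightarrow> real) \<Rightarrow> bool"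
  where "normed_space_on X N \<longleftrightarrow> subspace X \<and>
    (\<forall>f\<in>X. N f = 0 \<longleftrightarrow> f = 0) \<and>
    (\<forall>c. \<forall>f\<in>X. N (c *\<^sub>R f) = \<bar>c\<bar> * N f) \<and>
    (\<forall>f\<in>X. \<forall>g\<in>X. N (f + g) \<le> N f + N g)"

definition banach_space_on :: "'v::real_vector set \<Rightarrow> ('v \<Rightarrow> real) \<Rightarrow> bool"
  where "banach_space_on X N \<longleftrightarrow>
    normed_space_on X N \<and> Metric_space.mcomplete X (norm_dist X N)"

definition bounded_linear_on ::
    "'v::real_vector set \<Rightarrow> ('v \<Rightarrow> real) \<Rightarrow> ('v \<Rightarrow> 'v) \<Rightarrow> bool"
  where "bounded_linear_on X N L \<longleftrightarrow> L ` X \<subseteq> X \<and>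
    (\<forall>f\<in>X. \<forall>g\<in>X. L (f + g) = L f + L g) \<and>
    (\<forall>c. \<forall>f\<in>X. L (c *\<^sub>R f) = c *\<^sub>R L f) \<and>
    (\<exists>K. \<forall>f\<in>X. N (L f) \<le> K * N f)"

definition has_spectral_gap ::
    "'v::real_vector set \<Rightarrow> ('v \<Rightarrow> real) \<Rightarrow> ('v \<Rightarrow> 'v) \<Rightarrow> bool"
  where "has_spectral_gap X N L \<longleftrightarrow> banach_space_on X N \<and> bounded_linear_on X N L \<and>
    (\<exists>lam u0 G. 0 < lam \<and> u0 \<in> X \<and> u0 \<noteq> 0 \<and> L u0 = lam *\<^sub>R u0 \<and>
      subspace G \<and> closedin (Metric_space.mtopology X (norm_dist X N)) G \<and>
      span {u0} \<inter> G = {0} \<and> {v + g | v g. v \<in> span {u0} \<and> g \<in> G} = X \<and>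
      L ` G \<subseteq> G \<and>
      (\<exists>C>0. \<exists>\<delta>\<in>{0<..<1}. \<forall>n. \<forall>g\<in>G. N ((L ^^ n) g) \<le> C * lam ^ n * (1 - \<delta>) ^ n * N g))"

section \<open>Functions of bounded \<open>p\<close>-variation\<close>

definition pvar :: "real \<Rightarrow> real set \<Rightarrow> (real \<Rightarrow> real) \<Rightarrow> ennreal"
  where "pvar p \<Omega> f =
    (SUP (n, x) \<in> {(n :: nat, x :: nat \<Rightarrow> real). strict_mono_on {..n} x \<and> x ` {..n} \<subseteq> \<Omega>}.
      ennreal ((\<Sum>j=1..n. \<bar>f (x j) - f (x (j - 1))\<bar> powr p) powr (1 / p)))"

text \<open>A function on \<open>\<Omega>\<close> is represented by its extension by zero to the real line.\<close>

definition BV :: "real \<Rightarrow> real set \<Rightarrow> (real \<Rightarrow> real) set"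
  where "BV p \<Omega> = {f. (\<forall>x. x \<notin> \<Omega> \<longrightarrow> f x = 0) \<and> pvar p \<Omega> f < \<infinity>}"

text \<open>The real-valued supremum is meaningful on \<open>BV p \<Omega>\<close>, whose elements are bounded.\<close>

definition BV_norm :: "real \<Rightarrow> real set \<Rightarrow> (real \<Rightarrow> real) \<Rightarrow> real"
  where "BV_norm p \<Omega> f = (SUP x\<in>\<Omega>. \<bar>f x\<bar>) + enn2real (pvar p \<Omega> f)"

section \<open>Maps of class \<open>V\<close> and transfer operators\<close>

text \<open>\<open>I j\<close> is a codomain of \<open>b j\<close>; it is not required to be the range of \<open>b j\<close>.\<close>

definition class_V :: "real set \<Rightarrow> (real \<Rightarrow> real) \<Rightarrow> nat \<Rightarrow> (nat \<Rightarrow> real \<Rightarrow> real) \<Rightarrow> bool"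
  where "class_V \<Omega> T k b \<longleftrightarrow> T ` \<Omega> \<subseteq> \<Omega> \<and>
    (\<exists>I :: nat \<Rightarrow> real set.
      (\<forall>j\<in>{1..k}. is_interval (I j) \<and> I j \<subseteq> \<Omega> \<and> b j ` \<Omega> \<subseteq> I j \<and>
        (mono_on \<Omega> (b j) \<or> antimono_on \<Omega> (b j))) \<and>
      (\<forall>i\<in>{1..k}. \<forall>j\<in>{1..k}. i \<noteq> j \<longrightarrow> interior (I i) \<inter> interior (I j) = {})) \<and>
    countable {x \<in> \<Omega>. {y \<in> \<Omega>. T y = x} \<noteq> {b j x | j. j \<in> {1..k}}}"

definition transfer_op ::
    "real set \<Rightarrow> nat \<Rightarrow> (nat \<Rightarrow> real \<Rightarrow> real) \<Rightarrow> (real \<Rightarrow> real) \<Rightarrow> (real \<Rightarrow> real) \<Rightarrow> real \<Rightarrow> real"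
  where "transfer_op \<Omega> k b \<phi> f =
    (\<lambda>x. if x \<in> \<Omega> then 1 / real k * (\<Sum>j=1..k. exp (\<phi> (b j x)) * f (b j x)) else 0)"

end

theory Submission
  imports Defs
begin

text \<open>Write \<open>L\<close> for the transfer operator and \<open>\<theta> = k\<^sup>-\<^sup>1\<^sup>/\<^sup>p\<close>. Averaging over the inverse branches contracts the
  \<open>p\<close>-variation by \<open>\<theta>\<close>. With \<open>a = (1 - \<theta>) / 4\<close>, the bound on the potential makes \<open>L\<close> preserve the cone of
  positive functions whose variation is at most \<open>a\<close> times their infimum, and for \<open>v\<close> in the cone the
  normalised operator \<open>f \<mapsto> L (v f) / L v\<close> contracts the variation by a factor \<open>\<kappa> < 1\<close>. Applied to
  \<open>v = L\<^sup>n 1\<close>, this forces the ratios \<open>L\<^sup>n\<^sup>+\<^sup>1 1 / L\<^sup>n 1\<close> to become constant exponentially fast, and the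
  normalised iterates converge to a positive eigenfunction \<open>u\<close> in the cone. Applied to \<open>v = u\<close>, it
  shows that \<open>L\<^sup>n f / (\<lambda>\<^sup>n u)\<close> converges exponentially fast to a constant \<open>\<nu> f\<close>, and the kernel of \<open>\<nu>\<close> is the
  complementary invariant subspace.\<close>

section \<open>Bounds on the variation\<close>

lemma convex_on_powr_nonneg:
  fixes p :: real
  assumes "p \<ge> 1"
  shows "convex_on {0..} (\<lambda>x. x powr p)"
proof
  fix t x y :: real
  assume t: "t > 0" "t < 1" and xy: "x \<in> {0..}" "y \<in> {0..}"
  \<comment> \<open>Convexity on the positive reals leaves out the endpoint \<open>0\<close>; there
    the claim is this inequality for one of the two weights.\<close>
  have le: "s powr p \<le> s" if "0 < s" "s < 1" for s :: real
    using powr_mono'[of 1 p s] assms that by simp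
  consider "x = 0" | "y = 0" | "x > 0" "y > 0"
    using xy by fastforce
  then show "((1 - t) *\<^sub>R x + t *\<^sub>R y) powr p \<le> (1 - t) * x powr p + t * y powr p"
  proof cases
    case 1
    then show ?thesis
      using t xy le[of t] by (simp add: powr_mult mult_right_mono)
  next
    case 2
    then show ?thesis
      using t xy le[of "1 - t"] by (simp add: powr_mult mult_right_mono)
  next
    case 3
    then show ?thesis
      using convex_onD[OF powr_convex[OF assms], of t x y] t by simp
  qed
qed simp

text \<open>For positive \<open>A\<close> and \<open>B\<close>, \<open>u j + v j\<close> is
  \<open>A + B\<close> times the convex combination of \<open>u j / A\<close> and
  \<open>v j / B\<close> with weights \<open>A / (A + B)\<close> and \<open>B / (A + B)\<close>, so
  convexity applies termwise. If a bound is zero, one family vanishes and this normalisation is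
  replaced by a direct argument.\<close>

lemma minkowski_powr:
  fixes u v :: "'a \<Rightarrow> real"
  assumes p: "p \<ge> 1" and A: "A \<ge> 0" and B: "B \<ge> 0" and fin: "finite J"
    and u: "\<And>j. j \<in> J \<Longrightarrow> u j \<ge> 0" and v: "\<And>j. j \<in> J \<Longrightarrow> v j \<ge> 0"
    and uA: "(\<Sum>j\<in>J. u j powr p) \<le> A powr p" and vB: "(\<Sum>j\<in>J. v j powr p) \<le> B powr p"
  shows "(\<Sum>j\<in>J. (u j + v j) powr p) \<le> (A + B) powr p"
proof -
  consider "A = 0" | "B = 0" | "A > 0" "B > 0"
    using A B by fastforce
  then show ?thesis
  proof cases
    case 1
    then have "(\<Sum>j\<in>J. u j powr p) = 0"
      using uA sum_nonneg[of J "\<lambda>j. u j powr p"] p by (intro order_antisym) (simp_all del: sum_nonneg_eq_0_iff)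
    then have "\<forall>j\<in>J. u j = 0"
      using fin by (simp add: sum_nonneg_eq_0_iff)
    then show ?thesis using vB 1 by simp
  next
    case 2
    then have "(\<Sum>j\<in>J. v j powr p) = 0"
      using vB sum_nonneg[of J "\<lambda>j. v j powr p"] p by (intro order_antisym) (simp_all del: sum_nonneg_eq_0_iff)
    then have "\<forall>j\<in>J. v j = 0"
      using fin by (simp add: sum_nonneg_eq_0_iff)
    then show ?thesis using uA 2 by simp
  next
    case 3
    define t where "t = B / (A + B)"
    have t: "0 \<le> t" "t \<le> 1" "1 - t = A / (A + B)"
      using 3 by (auto simp: t_def field_simps)
    have "(u j + v j) powr p \<le> (A + B) powr p * ((1 - t) * (u j powr p / A powr p) + t * (v j powr p / B powr p))"
      if "j \<in> J" for j
    proof -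
      have "u j + v j = (A + B) * ((1 - t) * (u j / A) + t * (v j / B))"
        unfolding t(3) unfolding t_def using 3 by (simp add: add_divide_distrib[symmetric])
      then have "(u j + v j) powr p = (A + B) powr p * ((1 - t) * (u j / A) + t * (v j / B)) powr p"
        using 3 u[OF that] v[OF that] t by (simp add: powr_mult)
      also have "\<dots> \<le> (A + B) powr p * ((1 - t) * (u j / A) powr p + t * (v j / B) powr p)"
        using convex_onD[OF convex_on_powr_nonneg[OF p] t(1,2), of "u j / A" "v j / B"] u[OF that] v[OF that] 3
        by (intro mult_left_mono) auto
      finally show ?thesis
        using 3 u[OF that] v[OF that] by (simp add: powr_divide)
    qed
    then have "(\<Sum>j\<in>J. (u j + v j) powr p) \<le>
        (\<Sum>j\<in>J. (A + B) powr p * ((1 - t) * (u j powr p / A powr p) + t * (v j powr p / B powr p)))"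
      by (rule sum_mono)
    also have "\<dots> = (A + B) powr p * ((1 - t) * ((\<Sum>j\<in>J. u j powr p) / A powr p) + t * ((\<Sum>j\<in>J. v j powr p) / B powr p))"
      by (simp add: sum_distrib_left[symmetric] sum.distrib sum_divide_distrib[symmetric] times_divide_eq_right[symmetric] del: times_divide_eq_right)
    also have "\<dots> \<le> (A + B) powr p * ((1 - t) * 1 + t * 1)"
      using 3 t uA vB by (intro mult_left_mono add_mono) (auto simp: divide_le_eq_1)
    finally show ?thesis by simp
  qed
qed

lemma power_mean_powr:
  fixes t :: "'a \<Rightarrow> real"
  assumes "p \<ge> 1" "finite J" "J \<noteq> {}" "\<And>j. j \<in> J \<Longrightarrow> t j \<ge> 0"
  shows "((\<Sum>j\<in>J. t j) / card J) powr p \<le> (\<Sum>j\<in>J. t j powr p) / card J"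
  using convex_on_sum[OF assms(2,3) convex_on_powr_nonneg[OF assms(1)], of "\<lambda>_. 1 / card J" t] assms(2-)
  by (simp add: sum_divide_distrib[symmetric])

section \<open>Real upper bounds for the \<open>p\<close>-variation\<close>

definition var_seq :: "real set \<Rightarrow> nat \<Rightarrow> (nat \<Rightarrow> real) \<Rightarrow> bool"
  where "var_seq \<Omega> n x \<longleftrightarrow> strict_mono_on {..n} x \<and> x ` {..n} \<subseteq> \<Omega>"

definition var_sum :: "real \<Rightarrow> (real \<Rightarrow> real) \<Rightarrow> nat \<Rightarrow> (nat \<Rightarrow> real) \<Rightarrow> real"
  where "var_sum p f n x = (\<Sum>j=1..n. \<bar>f (x j) - f (x (j - 1))\<bar> powr p)"

text \<open>The variation enters the estimates only through upper bounds. This form keeps them real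
  and free of \<open>p\<close>-th roots; \<open>var_bound_iff_pvar\<close> is the link to
  \<open>pvar\<close>.\<close>

definition var_bound :: "real \<Rightarrow> real set \<Rightarrow> (real \<Rightarrow> real) \<Rightarrow> real \<Rightarrow> bool"
  where "var_bound p \<Omega> f B \<longleftrightarrow> 0 \<le> B \<and> (\<forall>n x. var_seq \<Omega> n x \<longrightarrow> var_sum p f n x \<le> B powr p)"

lemma var_bound_iff_pvar:
  assumes "p \<ge> 1"
  shows "var_bound p \<Omega> f B \<longleftrightarrow> 0 \<le> B \<and> pvar p \<Omega> f \<le> ennreal B"
proof -
  have "S powr (1 / p) \<le> B \<longleftrightarrow> S \<le> B powr p" if "0 \<le> B" "S \<ge> 0" for S
  proof -
    have "S powr (1 / p) \<le> B \<longleftrightarrow> (S powr (1 / p)) powr p \<le> B powr p"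
      using that assms powr_mono2[of p "S powr (1 / p)" B] powr_less_mono2[of p B "S powr (1 / p)"] by force
    then show ?thesis
      using that assms by (simp add: powr_powr)
  qed
  then show ?thesis
    unfolding pvar_def var_bound_def var_seq_def var_sum_def
    by (auto simp: SUP_le_iff sum_nonneg)
qed

lemma var_seqD: "var_seq \<Omega> n x \<Longrightarrow> j \<le> n \<Longrightarrow> x j \<in> \<Omega>"
  by (auto simp: var_seq_def)

lemma var_bound_nonneg: "var_bound p \<Omega> f B \<Longrightarrow> 0 \<le> B"
  by (simp add: var_bound_def)

text \<open>Minkowski's inequality applied to the increments. The pointwise hypothesis lets one
  lemma serve sums, products and quotients: for these, \<alpha> and \<beta> are uniform bounds on
  the other factors.\<close>

lemma var_bound_combine:
  assumes p: "p \<ge> 1" and \<alpha>: "\<alpha> \<ge> 0" and \<beta>: "\<beta> \<ge> 0"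
    and f: "var_bound p \<Omega> f A" and g: "var_bound p \<Omega> g B"
    and h: "\<And>x y. x \<in> \<Omega> \<Longrightarrow> y \<in> \<Omega> \<Longrightarrow> \<bar>h x - h y\<bar> \<le> \<alpha> * \<bar>f x - f y\<bar> + \<beta> * \<bar>g x - g y\<bar>"
    and C: "\<alpha> * A + \<beta> * B \<le> C"
  shows "var_bound p \<Omega> h C"
  unfolding var_bound_def
proof (intro conjI allI impI)
  have A: "0 \<le> A" and B: "0 \<le> B"
    using f g by (auto dest: var_bound_nonneg)
  have "0 \<le> \<alpha> * A" "0 \<le> \<beta> * B"
    using A B \<alpha> \<beta> by auto
  then show "0 \<le> C"
    using C by linarith
  fix n x assume x: "var_seq \<Omega> n x"
  let ?u = "\<lambda>j. \<alpha> * \<bar>f (x j) - f (x (j - 1))\<bar>" and ?v = "\<lambda>j. \<beta> * \<bar>g (x j) - g (x (j - 1))\<bar>"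
  have "(\<Sum>j=1..n. ?u j powr p) = \<alpha> powr p * var_sum p f n x"
    using \<alpha> by (simp add: var_sum_def powr_mult sum_distrib_left)
  also have "\<dots> \<le> (\<alpha> * A) powr p"
    using f x \<alpha> A by (auto simp: var_bound_def powr_mult intro: mult_left_mono)
  finally have u: "(\<Sum>j=1..n. ?u j powr p) \<le> (\<alpha> * A) powr p" .
  have "(\<Sum>j=1..n. ?v j powr p) = \<beta> powr p * var_sum p g n x"
    using \<beta> by (simp add: var_sum_def powr_mult sum_distrib_left)
  also have "\<dots> \<le> (\<beta> * B) powr p"
    using g x \<beta> B by (auto simp: var_bound_def powr_mult intro: mult_left_mono)
  finally have v: "(\<Sum>j=1..n. ?v j powr p) \<le> (\<beta> * B) powr p" .
  have "var_sum p h n x \<le> (\<Sum>j=1..n. (?u j + ?v j) powr p)"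
    unfolding var_sum_def
  proof (rule sum_mono)
    fix j assume j: "j \<in> {1..n}"
    show "\<bar>h (x j) - h (x (j - 1))\<bar> powr p \<le> (?u j + ?v j) powr p"
      using j p by (intro powr_mono2 h var_seqD[OF x]) auto
  qed
  also have "\<dots> \<le> (\<alpha> * A + \<beta> * B) powr p"
    using u v A B \<alpha> \<beta> by (intro minkowski_powr p) auto
  also have "\<dots> \<le> C powr p"
    using C p A B \<alpha> \<beta> by (intro powr_mono2) auto
  finally show "var_sum p h n x \<le> C powr p" .
qed

lemma var_bound_const: "(\<And>x. x \<in> \<Omega> \<Longrightarrow> f x = c) \<Longrightarrow> 0 \<le> B \<Longrightarrow> var_bound p \<Omega> f B"
  unfolding var_bound_def var_sum_def
  by (auto simp: var_seqD sum_nonneg intro!: order_trans[OF eq_refl[OF sum.neutral]])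

lemma var_bound_scale:
  assumes "p \<ge> 1" "\<alpha> \<ge> 0" "var_bound p \<Omega> f A" "\<alpha> * A \<le> C"
    "\<And>x y. x \<in> \<Omega> \<Longrightarrow> y \<in> \<Omega> \<Longrightarrow> \<bar>h x - h y\<bar> \<le> \<alpha> * \<bar>f x - f y\<bar>"
  shows "var_bound p \<Omega> h C"
  using var_bound_combine[OF assms(1,2) order_refl assms(3) var_bound_const[of \<Omega> "\<lambda>_. 0" 0 0], of h C] assms(4,5)
  by simp

lemma var_bound_mono: "p \<ge> 1 \<Longrightarrow> var_bound p \<Omega> f A \<Longrightarrow> A \<le> C \<Longrightarrow> var_bound p \<Omega> f C"
  by (rule var_bound_scale[of p 1]) auto

lemma var_bound_cong:
  assumes "p \<ge> 1" "var_bound p \<Omega> f A" "\<And>x. x \<in> \<Omega> \<Longrightarrow> g x = f x"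
  shows "var_bound p \<Omega> g A"
  by (rule var_bound_scale[OF assms(1) _ assms(2), of 1]) (auto simp: assms(3))

text \<open>A sequence of two points already sees the increment. This is how bounds on the variation
  become uniform bounds.\<close>

lemma var_bound_osc:
  assumes p: "p \<ge> 1" and f: "var_bound p \<Omega> f B" and "x \<in> \<Omega>" "y \<in> \<Omega>"
  shows "\<bar>f x - f y\<bar> \<le> B"
proof -
  have *: "\<bar>f y - f x\<bar> \<le> B" if "x < y" "x \<in> \<Omega>" "y \<in> \<Omega>" for x y
  proof -
    have "var_seq \<Omega> 1 (\<lambda>j. if j = 0 then x else y)"
      using that by (auto simp: var_seq_def strict_mono_on_def)
    then have "\<bar>f y - f x\<bar> powr p \<le> B powr p"
      using f by (fastforce simp: var_bound_def var_sum_def)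
    then show ?thesis
      using p var_bound_nonneg[OF f] by (meson abs_ge_zero not_le order_less_le_trans powr_less_mono2 zero_less_one)
  qed
  show ?thesis
    using *[of x y] *[of y x] assms var_bound_nonneg[OF f] by (cases x y rule: linorder_cases) (auto simp: abs_minus_commute)
qed

text \<open>Each variation sum involves finitely many points, hence passes to pointwise limits. The
  bounds may vary with \<open>n\<close>, as they do in the cone condition.\<close>

lemma var_bound_tendsto:
  assumes p: "p \<ge> 1" and Q: "\<And>n. var_bound p \<Omega> (F n) (B n)"
    and lim: "\<And>x. x \<in> \<Omega> \<Longrightarrow> (\<lambda>n. F n x) \<longlonglongrightarrow> f x" and B: "B \<longlonglongrightarrow> C"
  shows "var_bound p \<Omega> f C"
  unfolding var_bound_def
proof (intro conjI allI impI)
  show "0 \<le> C"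
    using B Q by (meson LIMSEQ_le_const var_bound_nonneg)
  fix n x assume x: "var_seq \<Omega> n x"
  have "(\<lambda>m. var_sum p (F m) n x) \<longlonglongrightarrow> var_sum p f n x"
    unfolding var_sum_def using p
    by (intro tendsto_sum tendsto_powr' tendsto_rabs tendsto_diff lim var_seqD[OF x] tendsto_const) auto
  moreover have "(\<lambda>m. B m powr p) \<longlonglongrightarrow> C powr p"
    using p Q by (intro tendsto_powr' B tendsto_const) (auto intro!: always_eventually dest: var_bound_nonneg)
  ultimately show "var_sum p f n x \<le> C powr p"
    using Q x by (auto intro!: LIMSEQ_le simp: var_bound_def)
qed

section \<open>Variation along disjoint intervals\<close>

lemma var_seq_append:
  assumes "var_seq \<Omega> n x" "x n < y" "y \<in> \<Omega>"
  shows "var_seq \<Omega> (Suc n) (x(Suc n := y))"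
    and "var_sum p f (Suc n) (x(Suc n := y)) = var_sum p f n x + \<bar>f y - f (x n)\<bar> powr p"
proof -
  have "x i < y" if "i \<le> n" for i
    using that assms(1,2) by (cases "i = n") (fastforce simp: var_seq_def strict_mono_on_def)+
  then show "var_seq \<Omega> (Suc n) (x(Suc n := y))"
    using assms by (auto simp: var_seq_def strict_mono_on_def le_Suc_eq)
  have "(\<Sum>j=1..n. \<bar>f ((x(Suc n := y)) j) - f ((x(Suc n := y)) (j - 1))\<bar> powr p) = var_sum p f n x"
    unfolding var_sum_def by (intro sum.cong) auto
  then show "var_sum p f (Suc n) (x(Suc n := y)) = var_sum p f n x + \<bar>f y - f (x n)\<bar> powr p"
    by (subst var_sum_def) simp
qed

text \<open>Sequences are strictly increasing, so nothing is appended when \<open>y = x n\<close>;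
  the extra term is then \<open>0 powr p = 0\<close>.\<close>

lemma var_seq_extend:
  assumes "var_seq \<Omega> n x" "x n \<le> y" "y \<in> \<Omega>"
  obtains m z where "var_seq \<Omega> m z" "z m = y" "var_sum p f n x + \<bar>f y - f (x n)\<bar> powr p \<le> var_sum p f m z"
proof (cases "x n = y")
  case True
  then show ?thesis
    using that[of n x] assms by simp
next
  case False
  then show ?thesis
    using that[of "Suc n" "x(Suc n := y)"] var_seq_append[OF assms(1) _ assms(3)] assms by simp
qed

text \<open>Induction by increasing right endpoints: a sequence for the earlier intervals ending at
  \<open>c i\<close> is extended by \<open>d i\<close> and then by \<open>e\<close>. Prescribing the
  last point \<open>e\<close> makes the induction hypothesis usable at \<open>c i\<close>, and the
  gaps between intervals only add nonnegative terms.\<close>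

lemma var_seq_disjoint_intervals:
  fixes c d :: "'a \<Rightarrow> real"
  assumes "finite J"
    and "\<And>i. i \<in> J \<Longrightarrow> c i < d i \<and> c i \<in> \<Omega> \<and> d i \<in> \<Omega>"
    and "\<And>i j. i \<in> J \<Longrightarrow> j \<in> J \<Longrightarrow> i \<noteq> j \<Longrightarrow> {c i<..<d i} \<inter> {c j<..<d j} = {}"
    and "e \<in> \<Omega>" and "\<And>i. i \<in> J \<Longrightarrow> d i \<le> e"
  shows "\<exists>n x. var_seq \<Omega> n x \<and> x n = e \<and> (\<Sum>i\<in>J. \<bar>f (d i) - f (c i)\<bar> powr p) \<le> var_sum p f n x"
  using assms
proof (induction J arbitrary: e rule: finite_ranking_induct[where f = d])
  case empty
  have "var_seq \<Omega> 0 (\<lambda>_. e)"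
    using empty by (auto simp: var_seq_def intro: strict_mono_onI)
  then show ?case
    by (force simp: var_sum_def)
next
  case (insert i J)
  show ?case
  proof (cases "i \<in> J")
    case True
    then show ?thesis
      using insert.IH[of e] insert.prems by (simp add: insert_absorb)
  next
    case False
    have i: "c i < d i" "c i \<in> \<Omega>" "d i \<in> \<Omega>" "d i \<le> e"
      using insert.prems by auto
    \<comment> \<open>Otherwise the midpoint between \<open>max (c i) (c j)\<close> and
      \<open>d j\<close> lies in both open intervals, because \<open>d i\<close> is the largest
      right endpoint.\<close>
    have "d j \<le> c i" if "j \<in> J" for j
    proof (rule ccontr)
      assume "\<not> d j \<le> c i"
      then have "(max (c i) (c j) + d j) / 2 \<in> {c i<..<d i} \<inter> {c j<..<d j}"
        using insert.hyps(2)[OF that] i insert.prems(1)[of j] that by auto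
      then show False
        using insert.prems(2)[of i j] that False by blast
    qed
    then obtain n x where x: "var_seq \<Omega> n x" "x n = c i"
      "(\<Sum>i\<in>J. \<bar>f (d i) - f (c i)\<bar> powr p) \<le> var_sum p f n x"
      using insert.IH[of "c i"] insert.prems i by auto
    then obtain m z where z: "var_seq \<Omega> m z" "z m = d i"
      "var_sum p f n x + \<bar>f (d i) - f (x n)\<bar> powr p \<le> var_sum p f m z"
      using var_seq_extend[of \<Omega> n x "d i" p f] i by auto
    then obtain m' z' where z': "var_seq \<Omega> m' z'" "z' m' = e"
      "var_sum p f m z + \<bar>f e - f (z m)\<bar> powr p \<le> var_sum p f m' z'"
      using var_seq_extend[of \<Omega> m z e p f] i insert.prems(3) by auto
    have "(\<Sum>i\<in>insert i J. \<bar>f (d i) - f (c i)\<bar> powr p) \<le> var_sum p f m z"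
      using x z False insert.hyps(1) by simp
    also have "\<dots> \<le> var_sum p f m' z'"
      using z'(3) powr_ge_zero[of "\<bar>f e - f (z m)\<bar>" p] by linarith
    finally show ?thesis
      using z' by blast
  qed
qed

lemma var_bound_disjoint_intervals:
  fixes c d :: "'a \<Rightarrow> real"
  assumes f: "var_bound p \<Omega> f B" and "finite J"
    and cd: "\<And>i. i \<in> J \<Longrightarrow> c i < d i \<and> c i \<in> \<Omega> \<and> d i \<in> \<Omega>"
    and "\<And>i j. i \<in> J \<Longrightarrow> j \<in> J \<Longrightarrow> i \<noteq> j \<Longrightarrow> {c i<..<d i} \<inter> {c j<..<d j} = {}"
  shows "(\<Sum>i\<in>J. \<bar>f (d i) - f (c i)\<bar> powr p) \<le> B powr p"
proof (cases "J = {}")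
  case False
  define e where "e = Max (d ` J)"
  have "e \<in> d ` J"
    unfolding e_def using assms(2) False by (intro Max_in) auto
  then have "e \<in> \<Omega>"
    using cd by auto
  moreover have "d i \<le> e" if "i \<in> J" for i
    unfolding e_def using assms(2) that by simp
  ultimately have "\<exists>n x. var_seq \<Omega> n x \<and> x n = e \<and> (\<Sum>i\<in>J. \<bar>f (d i) - f (c i)\<bar> powr p) \<le> var_sum p f n x"
    using cd by (intro var_seq_disjoint_intervals assms(2,4))
  then show ?thesis
    using f unfolding var_bound_def by (meson order_trans)
qed simp

text \<open>The images of consecutive points \<open>x (i - 1)\<close>, \<open>x i\<close> under all branches bound intervals with disjoint
  interiors, so that all branches together see at most the \<open>p\<close>-variation of \<open>f\<close>; the convexity of
  the \<open>p\<close>-th power turns the average over \<open>k\<close> branches into a gain of \<open>k\<^sup>-\<^sup>1\<^sup>/\<^sup>p\<close>.\<close>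

lemma var_bound_branch_average:
  assumes p: "p \<ge> 1" and k: "k \<ge> 1" and V: "class_V \<Omega> T k b" and f: "var_bound p \<Omega> f B"
  shows "var_bound p \<Omega> (\<lambda>x. (\<Sum>j=1..k. f (b j x)) / k) (real k powr (-1/p) * B)"
  unfolding var_bound_def
proof (intro conjI allI impI)
  have B: "0 \<le> B"
    using f by (rule var_bound_nonneg)
  then show "0 \<le> real k powr (-1/p) * B"
    by simp
  from V obtain I :: "nat \<Rightarrow> real set" where
      I': "\<forall>j\<in>{1..k}. is_interval (I j) \<and> I j \<subseteq> \<Omega> \<and> b j ` \<Omega> \<subseteq> I j \<and>
        (mono_on \<Omega> (b j) \<or> antimono_on \<Omega> (b j))"
      "\<forall>i\<in>{1..k}. \<forall>j\<in>{1..k}. i \<noteq> j \<longrightarrow> interior (I i) \<inter> interior (I j) = {}"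
    unfolding class_V_def by (elim conjE exE)
  have I: "is_interval (I j)" "I j \<subseteq> \<Omega>" "b j ` \<Omega> \<subseteq> I j" "mono_on \<Omega> (b j) \<or> antimono_on \<Omega> (b j)"
    if "j \<in> {1..k}" for j
    using bspec[OF I'(1) that] by blast+
  have disjI: "interior (I i) \<inter> interior (I j) = {}" if "i \<in> {1..k}" "j \<in> {1..k}" "i \<noteq> j" for i j
    using I'(2) that by blast
  fix n x assume x: "var_seq \<Omega> n x"
  define y where "y j i = b j (x i)" for j i
  \<comment> \<open>The minimum and maximum sort the two image points, since a branch may be
    decreasing.\<close>
  define c where "c = (\<lambda>(j, i). min (y j (i - 1)) (y j i))"
  define d where "d = (\<lambda>(j, i). max (y j (i - 1)) (y j i))"
  define R where "R = {1..k} \<times> {1..n}"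
  \<comment> \<open>Degenerate intervals, where a branch takes the same value twice, are discarded;
    they contribute nothing to the sum.\<close>
  define J where "J = {q \<in> R. c q < d q}"
  have y: "y j i \<in> I j" "y j i \<in> \<Omega>" if "j \<in> {1..k}" "i \<le> n" for i j
    using I(2,3)[OF that(1)] var_seqD[OF x that(2)] by (auto simp: y_def)
  have xmono: "x i \<le> x i'" if "i \<le> i'" "i' \<le> n" for i i'
    using x that strict_mono_onD[of "{..n}" x i i'] by (cases "i = i'") (auto simp: var_seq_def)
  \<comment> \<open>Disjointness has two sources: monotonicity within one branch, and the disjoint
    interiors of the sets \<open>I j\<close> for different branches.\<close>
  have same: "{c (j, i)<..<d (j, i)} \<inter> {c (j, i')<..<d (j, i')} = {}"
    if "j \<in> {1..k}" "i < i'" "i' \<le> n" for j i i'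
  proof -
    have *: "i - 1 \<le> i" "i \<le> i' - 1" "i' - 1 \<le> i'" "i \<le> n" "i' - 1 \<le> n"
      using that by auto
    have xs: "x (i - 1) \<in> \<Omega>" "x i \<in> \<Omega>" "x (i' - 1) \<in> \<Omega>" "x i' \<in> \<Omega>"
      using var_seqD[OF x] that by auto
    have xo: "x (i - 1) \<le> x i" "x i \<le> x (i' - 1)" "x (i' - 1) \<le> x i'"
      using xmono * that by auto
    from I(4)[OF that(1)] show ?thesis
    proof
      assume "mono_on \<Omega> (b j)"
      then have "y j (i - 1) \<le> y j i" "y j i \<le> y j (i' - 1)" "y j (i' - 1) \<le> y j i'"
        unfolding y_def using xs xo by (auto dest: mono_onD)
      then show ?thesis
        by (auto simp: c_def d_def)
    next
      assume "antimono_on \<Omega> (b j)"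
      then have "y j (i - 1) \<ge> y j i" "y j i \<ge> y j (i' - 1)" "y j (i' - 1) \<ge> y j i'"
        unfolding y_def using xs xo by (auto dest: monotone_onD)
      then show ?thesis
        by (auto simp: c_def d_def)
    qed
  qed
  have inI: "{c (j, i)<..<d (j, i)} \<subseteq> interior (I j)" if "j \<in> {1..k}" "i \<le> n" for j i
  proof (rule interior_maximal)
    have ci: "c (j, i) \<in> I j" "d (j, i) \<in> I j"
      using y(1)[OF that(1)] that by (auto simp: c_def d_def min_def max_def)
    show "{c (j, i)<..<d (j, i)} \<subseteq> I j"
    proof
      fix z assume "z \<in> {c (j, i)<..<d (j, i)}"
      then show "z \<in> I j"
        using I(1)[OF that(1)] ci unfolding is_interval_1 by (meson greaterThanLessThan_iff less_imp_le)
    qed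
  qed simp
  have disj: "{c q<..<d q} \<inter> {c q'<..<d q'} = {}" if qq: "q \<in> J" "q' \<in> J" "q \<noteq> q'" for q q'
  proof -
    obtain j i j' i' where q: "q = (j, i)" "q' = (j', i')"
      by (metis prod.exhaust)
    have r: "j \<in> {1..k}" "j' \<in> {1..k}" "i \<le> n" "i' \<le> n"
      using qq by (auto simp: J_def R_def q)
    show ?thesis
    proof (cases "j = j'")
      case True
      then have "i < i' \<or> i' < i"
        using qq q by auto
      then show ?thesis
        using same[of j i i'] same[of j i' i] r q True by blast
    next
      case False
      then show ?thesis
        using inI[of j i] inI[of j' i'] disjI[of j j'] r q by blast
    qed
  qed
  have "(\<Sum>q\<in>R. \<bar>f (d q) - f (c q)\<bar> powr p) = (\<Sum>q\<in>J. \<bar>f (d q) - f (c q)\<bar> powr p)"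
  proof (rule sum.mono_neutral_right)
    show "\<forall>q\<in>R - J. \<bar>f (d q) - f (c q)\<bar> powr p = 0"
    proof
      fix q assume "q \<in> R - J"
      moreover have "c q \<le> d q"
        by (cases q) (simp add: c_def d_def)
      ultimately have "c q = d q"
        by (auto simp: J_def)
      then show "\<bar>f (d q) - f (c q)\<bar> powr p = 0"
        by simp
    qed
  qed (auto simp: J_def R_def)
  also have "\<dots> \<le> B powr p"
  proof (rule var_bound_disjoint_intervals[OF f _ _ disj])
    show "finite J"
      by (simp add: J_def R_def)
    show "c q < d q \<and> c q \<in> \<Omega> \<and> d q \<in> \<Omega>" if "q \<in> J" for q
      using that y(2) by (auto simp: J_def R_def c_def d_def min_def max_def)
  qed
  finally have R: "(\<Sum>q\<in>R. \<bar>f (d q) - f (c q)\<bar> powr p) \<le> B powr p" .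
  have "var_sum p (\<lambda>x. (\<Sum>j=1..k. f (b j x)) / k) n x
      \<le> (\<Sum>i=1..n. (\<Sum>j=1..k. \<bar>f (y j i) - f (y j (i - 1))\<bar> powr p) / k)"
    unfolding var_sum_def
  proof (rule sum_mono)
    fix i assume "i \<in> {1..n}"
    have "\<bar>(\<Sum>j=1..k. f (b j (x i))) / k - (\<Sum>j=1..k. f (b j (x (i - 1)))) / k\<bar>
        = \<bar>\<Sum>j=1..k. f (y j i) - f (y j (i - 1))\<bar> / k"
      by (simp add: y_def sum_subtractf diff_divide_distrib[symmetric])
    also have "\<dots> \<le> (\<Sum>j=1..k. \<bar>f (y j i) - f (y j (i - 1))\<bar>) / card {1..k}"
      by (simp add: divide_right_mono)
    finally have "\<bar>(\<Sum>j=1..k. f (b j (x i))) / k - (\<Sum>j=1..k. f (b j (x (i - 1)))) / k\<bar> powr p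
        \<le> ((\<Sum>j=1..k. \<bar>f (y j i) - f (y j (i - 1))\<bar>) / card {1..k}) powr p"
      using p by (intro powr_mono2) auto
    also have "\<dots> \<le> (\<Sum>j=1..k. \<bar>f (y j i) - f (y j (i - 1))\<bar> powr p) / card {1..k}"
      using k by (intro power_mean_powr p) auto
    finally show "\<bar>(\<Sum>j=1..k. f (b j (x i))) / k - (\<Sum>j=1..k. f (b j (x (i - 1)))) / k\<bar> powr p
        \<le> (\<Sum>j=1..k. \<bar>f (y j i) - f (y j (i - 1))\<bar> powr p) / k"
      by simp
  qed
  also have "\<dots> = (\<Sum>j=1..k. \<Sum>i=1..n. \<bar>f (y j i) - f (y j (i - 1))\<bar> powr p) / k"
    by (subst sum.swap) (simp add: sum_divide_distrib)
  also have "(\<Sum>j=1..k. \<Sum>i=1..n. \<bar>f (y j i) - f (y j (i - 1))\<bar> powr p)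
      = (\<Sum>q\<in>R. \<bar>f (d q) - f (c q)\<bar> powr p)"
    unfolding R_def sum.cartesian_product
    by (intro sum.cong) (auto simp: c_def d_def min_def max_def abs_minus_commute)
  also have "\<dots> / k \<le> B powr p / k"
    using R by (intro divide_right_mono) auto
  also have "\<dots> = (real k powr (-1/p) * B) powr p"
  proof -
    have "-1 / p * p = -1"
      using p by simp
    then have "(real k powr (-1/p)) powr p = 1 / k"
      using k by (simp only: powr_powr) (simp add: powr_minus_divide)
    then show ?thesis
      using B by (simp add: powr_mult)
  qed
  finally show "var_sum p (\<lambda>x. (\<Sum>j=1..k. f (b j x)) / k) n x \<le> (real k powr (-1/p) * B) powr p" .
qed

section \<open>A criterion for a spectral gap\<close>

lemma normed_space_on_Metric_space:
  assumes "normed_space_on X N"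
  shows "Metric_space X (norm_dist X N)"
proof -
  have X: "subspace X" and N0: "\<And>f. f \<in> X \<Longrightarrow> N f = 0 \<longleftrightarrow> f = 0"
    and Ns: "\<And>c f. f \<in> X \<Longrightarrow> N (c *\<^sub>R f) = \<bar>c\<bar> * N f"
    and Nt: "\<And>f g. f \<in> X \<Longrightarrow> g \<in> X \<Longrightarrow> N (f + g) \<le> N f + N g"
    using assms by (auto simp: normed_space_on_def)
  have minus: "N (- f) = N f" if "f \<in> X" for f
    using Ns[OF that, of "-1"] by simp
  \<comment> \<open>Nonnegativity follows from the triangle inequality for \<open>f\<close> and
    \<open>- f\<close>.\<close>
  have nonneg: "0 \<le> N f" if "f \<in> X" for f
    using Nt[of f "- f"] minus[OF that] N0[of 0] that X by (simp add: subspace_0 subspace_neg)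
  show ?thesis
  proof
    fix f g h
    show "0 \<le> norm_dist X N f g"
      using nonneg X by (simp add: norm_dist_def subspace_diff)
    show "norm_dist X N f g = norm_dist X N g f"
      using minus[of "f - g"] X by (auto simp: norm_dist_def subspace_diff)
    show "norm_dist X N f g = 0 \<longleftrightarrow> f = g" if "f \<in> X" "g \<in> X"
      using N0[of "f - g"] X that by (simp add: norm_dist_def subspace_diff)
    show "norm_dist X N f h \<le> norm_dist X N f g + norm_dist X N g h"
      if "f \<in> X" "g \<in> X" "h \<in> X"
      using Nt[of "f - g" "g - h"] X that by (simp add: norm_dist_def subspace_diff)
  qed
qed

lemma normed_space_on_nonneg:
  assumes "normed_space_on X N" "f \<in> X"
  shows "0 \<le> N f"
  using Metric_space.nonneg[OF normed_space_on_Metric_space[OF assms(1)], of f 0] assms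
  by (simp add: norm_dist_def normed_space_on_def subspace_0)

text \<open>The functional \<nu> is a bounded eigenfunctional of \<open>L\<close>, and the
  complement is its kernel: boundedness makes it closed, the eigenvalue relation makes it invariant,
  and subtracting \<open>\<nu> f *\<^sub>R u\<close> projects onto it.\<close>

lemma has_spectral_gapI:
  assumes banach: "banach_space_on X N" and L: "bounded_linear_on X N L"
    and lam: "lam > 0" and u: "u \<in> X" "L u = lam *\<^sub>R u" "\<nu> u = 1"
    and \<nu>_add: "\<And>f g. f \<in> X \<Longrightarrow> g \<in> X \<Longrightarrow> \<nu> (f + g) = \<nu> f + \<nu> g"
    and \<nu>_scale: "\<And>c f. f \<in> X \<Longrightarrow> \<nu> (c *\<^sub>R f) = c * \<nu> f"
    and \<nu>_L: "\<And>f. f \<in> X \<Longrightarrow> \<nu> (L f) = lam * \<nu> f"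
    and \<nu>_bound: "\<And>f. f \<in> X \<Longrightarrow> \<bar>\<nu> f\<bar> \<le> C * N f"
    and decay: "\<And>f n. f \<in> X \<Longrightarrow> \<nu> f = 0 \<Longrightarrow> N ((L ^^ n) f) \<le> D * lam ^ n * \<kappa> ^ n * N f"
    and \<kappa>: "0 < \<kappa>" "\<kappa> < 1"
  shows "has_spectral_gap X N L"
proof -
  have ns: "normed_space_on X N" and X: "subspace X"
    using banach by (auto simp: banach_space_on_def normed_space_on_def)
  interpret Metric_space X "norm_dist X N"
    using ns by (rule normed_space_on_Metric_space)
  define G where "G = {f \<in> X. \<nu> f = 0}"
  have \<nu>0: "\<nu> 0 = 0"
    using \<nu>_scale[OF u(1), of 0] by simp
  have \<nu>_diff: "\<nu> (f - g) = \<nu> f - \<nu> g" if "f \<in> X" "g \<in> X" for f g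
    using \<nu>_add[of f "-1 *\<^sub>R g"] \<nu>_scale[of g "-1"] that X by (simp add: subspace_neg)
  have "subspace G"
    using X \<nu>0 \<nu>_add \<nu>_scale by (auto simp: G_def subspace_def)
  moreover have "closedin mtopology G"
    unfolding closedin_metric
  proof (intro conjI allI impI)
    fix f assume f: "f \<in> X - G"
    \<comment> \<open>Within distance \<open>r\<close> of \<open>f\<close> the functional changes by
      less than its value at \<open>f\<close>, so the kernel is not reached. The denominator is
      positive whatever the sign of \<open>C\<close>.\<close>
    define r where "r = \<bar>\<nu> f\<bar> / (\<bar>C\<bar> + 1)"
    have "disjnt G (mball f r)"
      unfolding disjnt_iff
    proof (intro allI notI)
      fix g assume g: "g \<in> G \<and> g \<in> mball f r"
      then have gX: "g \<in> X" "f - g \<in> X" and "\<nu> g = 0" and lt: "N (f - g) < r"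
        using f X by (auto simp: G_def norm_dist_def subspace_diff)
      then have "\<bar>\<nu> f\<bar> \<le> C * N (f - g)"
        using \<nu>_bound[OF gX(2)] \<nu>_diff[of f g] f by simp
      also have "\<dots> \<le> (\<bar>C\<bar> + 1) * N (f - g)"
        using normed_space_on_nonneg[OF ns gX(2)] by (intro mult_right_mono) auto
      also have "\<dots> < (\<bar>C\<bar> + 1) * r"
        using lt by (intro mult_strict_left_mono) auto
      also have "\<dots> = \<bar>\<nu> f\<bar>"
        by (simp add: r_def)
      finally show False by simp
    qed
    moreover have "r > 0"
      using f by (simp add: r_def G_def)
    ultimately show "\<exists>r>0. disjnt G (mball f r)"
      by blast
  qed (auto simp: G_def)
  moreover have "span {u} \<inter> G = {0}"
    using \<nu>_scale[OF u(1)] u(3) \<nu>0 X by (auto simp: span_singleton G_def subspace_0 intro: exI[of _ 0])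
  moreover have "{v + g |v g. v \<in> span {u} \<and> g \<in> G} = X"
  proof (intro equalityI subsetI)
    fix f assume "f \<in> {v + g |v g. v \<in> span {u} \<and> g \<in> G}"
    then show "f \<in> X"
      using X u(1) by (auto simp: span_singleton G_def intro!: subspace_add subspace_scale)
  next
    fix f assume f: "f \<in> X"
    have "f - \<nu> f *\<^sub>R u \<in> G"
      using f u X \<nu>_diff[of f "\<nu> f *\<^sub>R u"] \<nu>_scale[OF u(1)]
      by (auto simp: G_def intro: subspace_diff subspace_scale)
    moreover have "\<nu> f *\<^sub>R u \<in> span {u}" "f = \<nu> f *\<^sub>R u + (f - \<nu> f *\<^sub>R u)"
      by (auto simp: span_singleton)
    ultimately show "f \<in> {v + g |v g. v \<in> span {u} \<and> g \<in> G}"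
      by blast
  qed
  moreover have "L ` G \<subseteq> G"
    using L \<nu>_L by (auto simp: G_def bounded_linear_on_def)
  moreover have "u \<noteq> 0"
    using u(3) \<nu>0 by auto
  \<comment> \<open>The spectral gap asks for a positive constant, while \<open>D\<close> is an
    arbitrary real; hence \<open>max D 1\<close>.\<close>
  moreover have "\<forall>n. \<forall>g\<in>G. N ((L ^^ n) g) \<le> max D 1 * lam ^ n * (1 - (1 - \<kappa>)) ^ n * N g"
  proof (intro allI ballI)
    fix n g assume "g \<in> G"
    then have g: "g \<in> X" "\<nu> g = 0"
      by (auto simp: G_def)
    have "D * lam ^ n * \<kappa> ^ n * N g \<le> max D 1 * lam ^ n * \<kappa> ^ n * N g"
      using lam \<kappa> normed_space_on_nonneg[OF ns g(1)] by (intro mult_right_mono) auto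
    then show "N ((L ^^ n) g) \<le> max D 1 * lam ^ n * (1 - (1 - \<kappa>)) ^ n * N g"
      using decay[OF g, of n] by simp
  qed
  moreover have "max D 1 > 0" "1 - \<kappa> \<in> {0<..<1}"
    using \<kappa> by auto
  ultimately show ?thesis
    unfolding has_spectral_gap_def using banach L lam u(1,2) by blast
qed

section \<open>The Banach space of functions of bounded variation\<close>

lemma BV_iff:
  assumes "p \<ge> 1"
  shows "f \<in> BV p \<Omega> \<longleftrightarrow> (\<forall>x. x \<notin> \<Omega> \<longrightarrow> f x = 0) \<and> (\<exists>B. var_bound p \<Omega> f B)"
proof -
  have "pvar p \<Omega> f < \<infinity> \<longleftrightarrow> (\<exists>B. var_bound p \<Omega> f B)"
    unfolding var_bound_iff_pvar[OF assms]
    by (metis enn2real_nonneg ennreal_enn2real ennreal_less_top infinity_ennreal_def le_less_trans order_refl)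
  then show ?thesis
    by (simp add: BV_def)
qed

text \<open>The oscillation bound makes \<open>f\<close> bounded, so the real supremum in the norm
  is a genuine one. The rule hides the supremum and the conversion from \<open>ennreal\<close>
  behind two real bounds.\<close>

lemma BV_normE:
  assumes p: "p \<ge> 1" and "\<Omega> \<noteq> {}" and f: "f \<in> BV p \<Omega>"
  obtains S B where "0 \<le> S" "\<And>x. x \<in> \<Omega> \<Longrightarrow> \<bar>f x\<bar> \<le> S" "var_bound p \<Omega> f B" "BV_norm p \<Omega> f = S + B"
proof -
  let ?B = "enn2real (pvar p \<Omega> f)" and ?S = "SUP x\<in>\<Omega>. \<bar>f x\<bar>"
  have B: "var_bound p \<Omega> f ?B"
    using f by (simp add: var_bound_iff_pvar[OF p] BV_def)
  obtain x0 where x0: "x0 \<in> \<Omega>"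
    using assms(2) by auto
  have "\<bar>f x\<bar> \<le> \<bar>f x0\<bar> + ?B" if "x \<in> \<Omega>" for x
    using var_bound_osc[OF p B that x0] by linarith
  then have "bdd_above ((\<lambda>x. \<bar>f x\<bar>) ` \<Omega>)"
    by (intro bdd_aboveI2)
  then have S: "\<bar>f x\<bar> \<le> ?S" if "x \<in> \<Omega>" for x
    using that by (rule cSUP_upper[rotated])
  then show ?thesis
    using that[OF _ S B] order_trans[OF abs_ge_zero S[OF x0]] by (simp add: BV_norm_def)
qed

lemma BV_norm_le:
  assumes p: "p \<ge> 1" and "\<Omega> \<noteq> {}" and "\<And>x. x \<in> \<Omega> \<Longrightarrow> \<bar>f x\<bar> \<le> S" and B: "var_bound p \<Omega> f B"
  shows "BV_norm p \<Omega> f \<le> S + B"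
  unfolding BV_norm_def
proof (rule add_mono)
  show "(SUP x\<in>\<Omega>. \<bar>f x\<bar>) \<le> S"
    using assms by (intro cSUP_least)
  show "enn2real (pvar p \<Omega> f) \<le> B"
    using B by (simp add: var_bound_iff_pvar[OF p] enn2real_leI)
qed

lemma BV_norm_bounds:
  assumes p: "p \<ge> 1" and "\<Omega> \<noteq> {}" and f: "f \<in> BV p \<Omega>"
  shows "x \<in> \<Omega> \<Longrightarrow> \<bar>f x\<bar> \<le> BV_norm p \<Omega> f" and "var_bound p \<Omega> f (BV_norm p \<Omega> f)"
    and "0 \<le> BV_norm p \<Omega> f"
proof -
  obtain S B where *: "0 \<le> S" "\<And>x. x \<in> \<Omega> \<Longrightarrow> \<bar>f x\<bar> \<le> S" "var_bound p \<Omega> f B" "BV_norm p \<Omega> f = S + B"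
    using BV_normE[OF assms] by metis
  then show "x \<in> \<Omega> \<Longrightarrow> \<bar>f x\<bar> \<le> BV_norm p \<Omega> f" "var_bound p \<Omega> f (BV_norm p \<Omega> f)" "0 \<le> BV_norm p \<Omega> f"
    using var_bound_mono[OF p *(3), of "S + B"] var_bound_nonneg[OF *(3)] by force+
qed

lemma subspace_BV:
  assumes p: "p \<ge> 1"
  shows "subspace (BV p \<Omega>)"
  unfolding subspace_def
proof (intro conjI ballI allI)
  show "0 \<in> BV p \<Omega>"
    using var_bound_const[of \<Omega> "0 :: real \<Rightarrow> real" 0 0] by (auto simp: BV_iff[OF p])
next
  fix f g assume f: "f \<in> BV p \<Omega>" and g: "g \<in> BV p \<Omega>"
  then obtain A B where A: "var_bound p \<Omega> f A" and B: "var_bound p \<Omega> g B"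
    by (auto simp: BV_iff[OF p])
  have "var_bound p \<Omega> (f + g) (A + B)"
    by (rule var_bound_combine[OF p _ _ A B, of 1 1]) auto
  then show "f + g \<in> BV p \<Omega>"
    using f g by (auto simp: BV_iff[OF p])
next
  fix c :: real and f assume f: "f \<in> BV p \<Omega>"
  then obtain A where A: "var_bound p \<Omega> f A"
    by (auto simp: BV_iff[OF p])
  have "var_bound p \<Omega> (c *\<^sub>R f) (\<bar>c\<bar> * A)"
    by (rule var_bound_scale[OF p _ A, of "\<bar>c\<bar>"])
      (auto simp: scaleR_fun_def abs_mult[symmetric] right_diff_distrib[symmetric])
  then show "c *\<^sub>R f \<in> BV p \<Omega>"
    using f by (auto simp: BV_iff[OF p] scaleR_fun_def)
qed

lemma normed_space_on_BV:
  assumes p: "p \<ge> 1" and ne: "\<Omega> \<noteq> {}"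
  shows "normed_space_on (BV p \<Omega>) (BV_norm p \<Omega>)"
proof -
  have zero: "BV_norm p \<Omega> 0 \<le> 0"
    using BV_norm_le[OF p ne, of 0 0 0] var_bound_const[of \<Omega> 0 0 0 p] by simp
  have scale: "BV_norm p \<Omega> (c *\<^sub>R f) \<le> \<bar>c\<bar> * BV_norm p \<Omega> f" if f: "f \<in> BV p \<Omega>" for c f
  proof -
    obtain S B where *: "0 \<le> S" "\<And>x. x \<in> \<Omega> \<Longrightarrow> \<bar>f x\<bar> \<le> S" "var_bound p \<Omega> f B" "BV_norm p \<Omega> f = S + B"
      using BV_normE[OF p ne f] by metis
    have "BV_norm p \<Omega> (c *\<^sub>R f) \<le> \<bar>c\<bar> * S + \<bar>c\<bar> * B"
    proof (rule BV_norm_le[OF p ne])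
      show "\<bar>(c *\<^sub>R f) x\<bar> \<le> \<bar>c\<bar> * S" if "x \<in> \<Omega>" for x
        using *(2)[OF that] by (simp add: scaleR_fun_def abs_mult mult_left_mono)
      show "var_bound p \<Omega> (c *\<^sub>R f) (\<bar>c\<bar> * B)"
        by (rule var_bound_scale[OF p _ *(3), of "\<bar>c\<bar>"])
          (auto simp: scaleR_fun_def abs_mult[symmetric] right_diff_distrib[symmetric])
    qed
    then show ?thesis
      by (simp add: *(4) distrib_left)
  qed
  show ?thesis
    unfolding normed_space_on_def
  proof (intro conjI ballI allI)
    show "subspace (BV p \<Omega>)"
      using p by (rule subspace_BV)
  next
    fix f assume f: "f \<in> BV p \<Omega>"
    show "BV_norm p \<Omega> f = 0 \<longleftrightarrow> f = 0"
    proof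
      assume 0: "BV_norm p \<Omega> f = 0"
      show "f = 0"
      proof
        fix x show "f x = 0 x"
          using BV_norm_bounds(1)[OF p ne f, of x] f 0 by (cases "x \<in> \<Omega>") (auto simp: BV_def)
      qed
    next
      assume "f = 0"
      then show "BV_norm p \<Omega> f = 0"
        using zero BV_norm_bounds(3)[OF p ne f] by simp
    qed
  next
    fix c f assume f: "f \<in> BV p \<Omega>"
    show "BV_norm p \<Omega> (c *\<^sub>R f) = \<bar>c\<bar> * BV_norm p \<Omega> f"
    proof (cases "c = 0")
      case True
      then show ?thesis
        using scale[OF f, of 0] BV_norm_bounds(3)[OF p ne subspace_0[OF subspace_BV[OF p]]] by simp
    next
      case False
      \<comment> \<open>The reverse inequality is \<open>scale\<close> for the inverse
        factor.\<close>
      then have "\<bar>c\<bar> * BV_norm p \<Omega> f \<le> BV_norm p \<Omega> (c *\<^sub>R f)"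
        using scale[OF subspace_scale[OF subspace_BV[OF p] f], of "inverse c" c]
        by (simp add: field_simps)
      then show ?thesis
        using scale[OF f, of c] by simp
    qed
  next
    fix f g assume fg: "f \<in> BV p \<Omega>" "g \<in> BV p \<Omega>"
    obtain S B where f: "0 \<le> S" "\<And>x. x \<in> \<Omega> \<Longrightarrow> \<bar>f x\<bar> \<le> S" "var_bound p \<Omega> f B" "BV_norm p \<Omega> f = S + B"
      using BV_normE[OF p ne fg(1)] by metis
    obtain S' B' where g: "0 \<le> S'" "\<And>x. x \<in> \<Omega> \<Longrightarrow> \<bar>g x\<bar> \<le> S'" "var_bound p \<Omega> g B'" "BV_norm p \<Omega> g = S' + B'"
      using BV_normE[OF p ne fg(2)] by metis
    have "BV_norm p \<Omega> (f + g) \<le> (S + S') + (B + B')"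
    proof (rule BV_norm_le[OF p ne])
      show "\<bar>(f + g) x\<bar> \<le> S + S'" if "x \<in> \<Omega>" for x
        using f(2)[OF that] g(2)[OF that] by simp
      show "var_bound p \<Omega> (f + g) (B + B')"
        by (rule var_bound_combine[OF p _ _ f(3) g(3), of 1 1]) auto
    qed
    then show "BV_norm p \<Omega> (f + g) \<le> BV_norm p \<Omega> f + BV_norm p \<Omega> g"
      by (simp add: f(4) g(4))
  qed
qed

text \<open>A Cauchy sequence converges pointwise to some \<open>f\<close>. Both parts of the norm
  of \<open>\<sigma> n - f\<close> are controlled as pointwise limits of
  \<open>\<sigma> n - \<sigma> i\<close>, and \<open>f\<close> belongs to the space as
  \<open>\<sigma> n\<close> minus such a difference.\<close>

lemma banach_space_on_BV:
  assumes p: "p \<ge> 1" and ne: "\<Omega> \<noteq> {}"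
  shows "banach_space_on (BV p \<Omega>) (BV_norm p \<Omega>)"
proof -
  note ns = normed_space_on_BV[OF assms]
  note BV = subspace_BV[OF p, of \<Omega>]
  interpret Metric_space "BV p \<Omega>" "norm_dist (BV p \<Omega>) (BV_norm p \<Omega>)"
    using ns by (rule normed_space_on_Metric_space)
  have "\<exists>f. limitin mtopology \<sigma> f sequentially" if "MCauchy \<sigma>" for \<sigma>
  proof -
    have \<sigma>: "\<sigma> n \<in> BV p \<Omega>" for n
      using that by (auto simp: MCauchy_def)
    have cauchy: "\<exists>M. \<forall>n\<ge>M. \<forall>n'\<ge>M. BV_norm p \<Omega> (\<sigma> n - \<sigma> n') < e" if "e > 0" for e
      using \<open>MCauchy \<sigma>\<close> that unfolding MCauchy_def norm_dist_def by (simp add: \<sigma>)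
    have pw: "\<bar>\<sigma> n x - \<sigma> n' x\<bar> \<le> BV_norm p \<Omega> (\<sigma> n - \<sigma> n')" if "x \<in> \<Omega>" for n n' x
      using BV_norm_bounds(1)[OF p ne subspace_diff[OF BV \<sigma> \<sigma>] that] by simp
    have "Cauchy (\<lambda>n. \<sigma> n x)" for x
    proof (cases "x \<in> \<Omega>")
      case True
      show ?thesis
      proof (rule metric_CauchyI)
        fix e :: real assume "e > 0"
        then show "\<exists>M. \<forall>m\<ge>M. \<forall>n\<ge>M. dist (\<sigma> m x) (\<sigma> n x) < e"
          using cauchy[of e] pw[OF True] unfolding dist_real_def by (meson le_less_trans)
      qed
    next
      case False
      then have "(\<lambda>n. \<sigma> n x) = (\<lambda>n. 0)"
        using \<sigma> by (auto simp: BV_def)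
      then show ?thesis
        by (simp add: Cauchy_convergent_iff convergent_const)
    qed
    then have lim: "(\<lambda>n. \<sigma> n x) \<longlonglongrightarrow> lim (\<lambda>n. \<sigma> n x)" for x
      by (simp add: Cauchy_convergent_iff convergent_LIMSEQ_iff)
    define f where "f x = lim (\<lambda>n. \<sigma> n x)" for x
    have f: "(\<lambda>n. \<sigma> n x) \<longlonglongrightarrow> f x" for x
      unfolding f_def by (rule lim)
    have f0: "f x = 0" if "x \<notin> \<Omega>" for x
    proof -
      have "\<sigma> n x = 0" for n
        using \<sigma> that by (auto simp: BV_def)
      then show ?thesis
        using f[of x] by (simp add: LIMSEQ_const_iff)
    qed
    have close: "\<exists>M. \<forall>n\<ge>M. \<sigma> n - f \<in> BV p \<Omega> \<and> BV_norm p \<Omega> (\<sigma> n - f) < e" if "e > 0" for e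
    proof -
      obtain M where M: "\<And>n n'. n \<ge> M \<Longrightarrow> n' \<ge> M \<Longrightarrow> BV_norm p \<Omega> (\<sigma> n - \<sigma> n') < e / 3"
        using cauchy[of "e / 3"] \<open>e > 0\<close> by auto
      \<comment> \<open>The shift makes the Cauchy bound hold at every index, as
        \<open>var_bound_tendsto\<close> requires.\<close>
      have f_shift: "(\<lambda>i. \<sigma> (i + M) x) \<longlonglongrightarrow> f x" for x
        by (rule LIMSEQ_ignore_initial_segment[OF f])
      have "\<sigma> n - f \<in> BV p \<Omega> \<and> BV_norm p \<Omega> (\<sigma> n - f) < e" if n: "n \<ge> M" for n
      proof -
        have "\<bar>(\<sigma> n - f) x\<bar> \<le> e / 3" if "x \<in> \<Omega>" for x
        proof (rule LIMSEQ_le_const2)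
          show "(\<lambda>i. \<bar>\<sigma> n x - \<sigma> (i + M) x\<bar>) \<longlonglongrightarrow> \<bar>(\<sigma> n - f) x\<bar>"
            unfolding fun_diff_def by (intro tendsto_intros f_shift)
          show "\<exists>N. \<forall>i\<ge>N. \<bar>\<sigma> n x - \<sigma> (i + M) x\<bar> \<le> e / 3"
            using order_trans[OF pw[OF that] less_imp_le[OF M[OF n le_add2]]] by blast
        qed
        moreover have vb: "var_bound p \<Omega> (\<sigma> n - f) (e / 3)"
        proof (rule var_bound_tendsto[OF p])
          show "var_bound p \<Omega> (\<sigma> n - \<sigma> (i + M)) (e / 3)" for i
            by (rule var_bound_mono[OF p BV_norm_bounds(2)[OF p ne subspace_diff[OF BV \<sigma> \<sigma>]]
                less_imp_le[OF M[OF n le_add2]]])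
          show "(\<lambda>i. (\<sigma> n - \<sigma> (i + M)) x) \<longlonglongrightarrow> (\<sigma> n - f) x" for x
            unfolding fun_diff_def by (intro tendsto_intros f_shift)
        qed simp
        ultimately have "BV_norm p \<Omega> (\<sigma> n - f) \<le> e / 3 + e / 3"
          by (rule BV_norm_le[OF p ne])
        moreover have "\<sigma> n - f \<in> BV p \<Omega>"
          using vb \<sigma>[of n] f0 by (auto simp: BV_iff[OF p])
        ultimately show ?thesis
          using \<open>e > 0\<close> by simp
      qed
      then show ?thesis by auto
    qed
    have fBV: "f \<in> BV p \<Omega>"
    proof -
      obtain n where "\<sigma> n - f \<in> BV p \<Omega>"
        using close[of 1] by auto
      then show ?thesis
        using subspace_diff[OF BV \<sigma>[of n], of "\<sigma> n - f"] by simp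
    qed
    have "limitin mtopology \<sigma> f sequentially"
      unfolding limitin_metric
    proof (intro conjI allI impI fBV)
      fix e :: real assume "e > 0"
      then show "\<forall>\<^sub>F n in sequentially. \<sigma> n \<in> BV p \<Omega> \<and> norm_dist (BV p \<Omega>) (BV_norm p \<Omega>) (\<sigma> n) f < e"
        using close[of e] \<sigma> fBV by (auto simp: eventually_sequentially norm_dist_def)
    qed
    then show ?thesis by blast
  qed
  then show ?thesis
    using ns by (simp add: banach_space_on_def mcomplete_def)
qed

section \<open>Geometric convergence; increments of products and quotients\<close>

lemma convergent_geometric_increments:
  fixes s :: "nat \<Rightarrow> real"
  assumes "0 \<le> \<kappa>" "\<kappa> < 1" and s: "\<And>n. \<bar>s (Suc n) - s n\<bar> \<le> C * \<kappa> ^ n"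
  shows "convergent s"
proof -
  have "summable (\<lambda>n. s (Suc n) - s n)"
  proof (rule summable_comparison_test'[of _ 0])
    show "summable (\<lambda>n. C * \<kappa> ^ n)"
      using assms(1,2) by (intro summable_mult summable_geometric) auto
  qed (use s in simp)
  then have "(\<lambda>n. \<Sum>i<n. s (Suc i) - s i) \<longlonglongrightarrow> (\<Sum>i. s (Suc i) - s i)"
    by (rule summable_LIMSEQ)
  then have "(\<lambda>n. s n - s 0) \<longlonglongrightarrow> (\<Sum>i. s (Suc i) - s i)"
    by (simp add: sum_lessThan_telescope)
  then have "(\<lambda>n. (s n - s 0) + s 0) \<longlonglongrightarrow> (\<Sum>i. s (Suc i) - s i) + s 0"
    by (intro tendsto_add tendsto_const)
  then show ?thesis
    by (auto simp: convergent_def)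
qed

lemma abs_mult_diff_le:
  fixes x y x' y' :: real
  assumes "\<bar>x\<bar> \<le> S" "\<bar>y'\<bar> \<le> S'"
  shows "\<bar>x * y - x' * y'\<bar> \<le> S * \<bar>y - y'\<bar> + S' * \<bar>x - x'\<bar>"
proof -
  have "x * y - x' * y' = x * (y - y') + y' * (x - x')"
    by (simp add: algebra_simps)
  then have "\<bar>x * y - x' * y'\<bar> \<le> \<bar>x\<bar> * \<bar>y - y'\<bar> + \<bar>y'\<bar> * \<bar>x - x'\<bar>"
    by (metis abs_mult abs_triangle_ineq)
  also have "\<dots> \<le> S * \<bar>y - y'\<bar> + S' * \<bar>x - x'\<bar>"
    using assms by (intro add_mono mult_right_mono) auto
  finally show ?thesis .
qed

text \<open>The bound \<open>S\<close> is placed on the quotient \<open>x' / y'\<close> and not on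
  \<open>x'\<close>, so that only one factor \<open>1 / c\<close> appears. The conclusion has the
  shape that \<open>var_bound_combine\<close> takes as hypothesis.\<close>

lemma abs_divide_diff_le:
  fixes x y x' y' :: real
  assumes "0 < c" "c \<le> y" "c \<le> y'" "\<bar>x'\<bar> \<le> S * y'"
  shows "\<bar>x / y - x' / y'\<bar> \<le> (1 / c) * \<bar>x - x'\<bar> + (S / c) * \<bar>y - y'\<bar>"
proof -
  have "x / y - x' / y' = (x - x') * (1 / y) - (x' / y') * ((y - y') * (1 / y))"
    using assms by (simp add: field_simps)
  then have "\<bar>x / y - x' / y'\<bar> \<le> \<bar>x - x'\<bar> * (1 / y) + \<bar>x' / y'\<bar> * (\<bar>y - y'\<bar> * (1 / y))"
    using assms abs_triangle_ineq4[of "(x - x') * (1 / y)" "(x' / y') * ((y - y') * (1 / y))"]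
    by (simp add: abs_mult)
  also have "\<dots> \<le> \<bar>x - x'\<bar> * (1 / c) + S * (\<bar>y - y'\<bar> * (1 / c))"
  proof (intro add_mono mult_mono mult_left_mono)
    show "1 / y \<le> 1 / c"
      using assms by (simp add: frac_le)
    show "1 / y \<le> 1 / c"
      using assms by (simp add: frac_le)
    show le: "\<bar>x' / y'\<bar> \<le> S"
      using assms by (simp add: divide_le_eq)
    then show "0 \<le> S"
      by linarith
  qed (use assms in auto)
  finally show ?thesis
    by (simp add: mult.commute)
qed

section \<open>Transfer operators with a contracted cone\<close>

text \<open>\<open>m\<close>, \<open>M\<close> and \<open>V\<close> bound the weight and its
  variation, and \<open>a\<close> is the aperture of the cone. \<open>invariance\<close> says that
  the variation of \<open>L v\<close>, at most \<open>\<theta> * (M * a + V * (1 + a))\<close> times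
  the infimum of \<open>v\<close>, is within \<open>a\<close> times the lower bound
  \<open>m * inf v\<close> of \<open>L v\<close>. The constant \<kappa> is the contraction factor of
  the normalised operator.\<close>

locale bv_transfer =
  fixes \<Omega> :: "real set" and T :: "real \<Rightarrow> real" and k :: nat
    and b :: "nat \<Rightarrow> real \<Rightarrow> real" and p :: real and \<phi> :: "real \<Rightarrow> real"
    and m M V a \<theta> \<kappa> :: real
  assumes ne: "\<Omega> \<noteq> {}" and class_V: "class_V \<Omega> T k b" and k: "k \<ge> 1" and p: "p \<ge> 1"
    and m: "0 < m" and weight: "\<And>x. x \<in> \<Omega> \<Longrightarrow> m \<le> exp (\<phi> x)" "\<And>x. x \<in> \<Omega> \<Longrightarrow> exp (\<phi> x) \<le> M"
    and weight_var: "var_bound p \<Omega> (\<lambda>x. exp (\<phi> x)) V"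
    and a: "0 < a" and \<theta>: "\<theta> = real k powr (-1/p)"
    and invariance: "\<theta> * (M * a + V * (1 + a)) \<le> a * m"
    and \<kappa>: "\<kappa> = \<theta> * (M / m) * (1 + a) + 2 * a" "\<kappa> < 1"
begin

abbreviation L :: "(real \<Rightarrow> real) \<Rightarrow> real \<Rightarrow> real"
  where "L \<equiv> transfer_op \<Omega> k b \<phi>"

abbreviation X :: "(real \<Rightarrow> real) set"
  where "X \<equiv> BV p \<Omega>"

abbreviation N :: "(real \<Rightarrow> real) \<Rightarrow> real"
  where "N \<equiv> BV_norm p \<Omega>"

section \<open>Elementary properties of the transfer operator\<close>

lemma \<theta>_pos: "0 < \<theta>"
  using k by (simp add: \<theta>)

lemma M_pos: "0 < M"
proof -
  obtain x where "x \<in> \<Omega>"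
    using ne by auto
  then show ?thesis
    using m weight[of x] by linarith
qed

lemma \<kappa>_pos: "0 < \<kappa>"
  using \<theta>_pos M_pos m a by (auto simp: \<kappa> intro!: add_pos_pos)

lemma branch_in: "x \<in> \<Omega> \<Longrightarrow> j \<in> {1..k} \<Longrightarrow> b j x \<in> \<Omega>"
  using class_V unfolding class_V_def by blast

lemma L_eq: "x \<in> \<Omega> \<Longrightarrow> L f x = (\<Sum>j=1..k. exp (\<phi> (b j x)) * f (b j x)) / k"
  by (simp add: transfer_op_def)

lemma L_outside: "x \<notin> \<Omega> \<Longrightarrow> L f x = 0"
  by (simp add: transfer_op_def)

lemma L_cong: "(\<And>x. x \<in> \<Omega> \<Longrightarrow> f x = h x) \<Longrightarrow> L f = L h"
  unfolding transfer_op_def using branch_in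
  by (intro ext if_cong refl arg_cong2[of _ _ _ _ "(*)"] sum.cong) auto

lemma L_mono: "(\<And>y. y \<in> \<Omega> \<Longrightarrow> f y \<le> h y) \<Longrightarrow> L f x \<le> L h x"
  using branch_in by (cases "x \<in> \<Omega>") (auto simp: L_eq L_outside intro!: divide_right_mono sum_mono)

lemma L_add: "L (f + h) = L f + L h"
  by (rule ext) (simp add: transfer_op_def distrib_left sum.distrib add_divide_distrib)

lemma L_scale: "L (c *\<^sub>R f) = c *\<^sub>R L f"
  by (rule ext) (simp add: transfer_op_def scaleR_fun_def sum_distrib_left mult_ac)

lemma L_funpow_add: "(L ^^ n) (f + h) = (L ^^ n) f + (L ^^ n) h"
  by (induction n) (simp_all only: funpow.simps comp_apply id_apply L_add)

lemma L_funpow_scale: "(L ^^ n) (c *\<^sub>R f) = c *\<^sub>R (L ^^ n) f"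
  by (induction n) (simp_all only: funpow.simps comp_apply id_apply L_scale)

lemma L_scale_pointwise: "L (\<lambda>y. c * f y) x = c * L f x"
  using fun_cong[OF L_scale[of c f], of x] by (simp add: scaleR_fun_def)

lemma L_lower: "x \<in> \<Omega> \<Longrightarrow> 0 \<le> c \<Longrightarrow> (\<And>y. y \<in> \<Omega> \<Longrightarrow> c \<le> f y) \<Longrightarrow> m * c \<le> L f x"
proof -
  assume x: "x \<in> \<Omega>" and c: "0 \<le> c" "\<And>y. y \<in> \<Omega> \<Longrightarrow> c \<le> f y"
  have "(\<Sum>j=1..k. m * c) \<le> (\<Sum>j=1..k. exp (\<phi> (b j x)) * f (b j x))"
    using c(1) m by (intro sum_mono mult_mono weight c(2) branch_in[OF x]) auto
  then show "m * c \<le> L f x"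
    using k by (simp add: L_eq[OF x] field_simps)
qed

lemma L_bounded: "x \<in> \<Omega> \<Longrightarrow> (\<And>y. y \<in> \<Omega> \<Longrightarrow> \<bar>f y\<bar> \<le> S) \<Longrightarrow> \<bar>L f x\<bar> \<le> M * S"
proof -
  assume x: "x \<in> \<Omega>" and S: "\<And>y. y \<in> \<Omega> \<Longrightarrow> \<bar>f y\<bar> \<le> S"
  have "\<bar>\<Sum>j=1..k. exp (\<phi> (b j x)) * f (b j x)\<bar> \<le> (\<Sum>j=1..k. M * S)"
    using M_pos
    by (intro order_trans[OF sum_abs] sum_mono, unfold abs_mult)
      (intro mult_mono S branch_in[OF x], auto intro!: weight branch_in[OF x])
  then show "\<bar>L f x\<bar> \<le> M * S"
    using k by (simp add: L_eq[OF x] field_simps)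
qed

lemma var_bound_L:
  assumes "var_bound p \<Omega> (\<lambda>x. exp (\<phi> x) * f x) B"
  shows "var_bound p \<Omega> (L f) (\<theta> * B)"
  unfolding \<theta> by (rule var_bound_cong[OF p var_bound_branch_average[OF p k class_V assms]]) (simp add: L_eq)

text \<open>As \<open>x\<close> is arbitrary, the condition says that the variation of \<open>v\<close> is at most \<open>a * inf v\<close>; in this
  form it is visibly stable under pointwise limits.\<close>

definition cone :: "(real \<Rightarrow> real) \<Rightarrow> bool"
  where "cone v \<longleftrightarrow> (\<forall>x\<in>\<Omega>. 0 < v x \<and> var_bound p \<Omega> v (a * v x))"

lemma cone_pos: "cone v \<Longrightarrow> x \<in> \<Omega> \<Longrightarrow> 0 < v x"
  by (simp add: cone_def)

lemma cone_compare: "cone v \<Longrightarrow> x \<in> \<Omega> \<Longrightarrow> y \<in> \<Omega> \<Longrightarrow> v x \<le> (1 + a) * v y"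
  using var_bound_osc[OF p, of \<Omega> v "a * v y" x y] by (auto simp: cone_def algebra_simps)

text \<open>With \<open>c\<close> the infimum of \<open>v\<close>, comparison of values gives the
  upper bound. For the variation bound, \<open>B\<close> is the exact variation: being at most
  \<open>a * v x\<close> at every point, it is at most \<open>a * c\<close>.\<close>

lemma cone_inf:
  assumes v: "cone v"
  obtains c where "0 < c" "\<And>x. x \<in> \<Omega> \<Longrightarrow> c \<le> v x" "\<And>x. x \<in> \<Omega> \<Longrightarrow> v x \<le> (1 + a) * c"
    "var_bound p \<Omega> v (a * c)"
proof -
  define c where "c = Inf (v ` \<Omega>)"
  define B where "B = enn2real (pvar p \<Omega> v)"
  obtain x0 where x0: "x0 \<in> \<Omega>"
    using ne by auto
  have bdd: "bdd_below (v ` \<Omega>)"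
    using cone_pos[OF v] by (intro bdd_belowI2[of _ 0]) (auto intro: less_imp_le)
  have upper: "v x \<le> (1 + a) * c" if "x \<in> \<Omega>" for x
  proof -
    have "v x / (1 + a) \<le> c"
      unfolding c_def using cone_compare[OF v that] a ne
      by (intro cINF_greatest) (auto simp: divide_le_eq mult.commute)
    then show ?thesis
      using a by (simp add: divide_le_eq mult.commute)
  qed
  have "0 < (1 + a) * c"
    using upper[OF x0] cone_pos[OF v x0] by linarith
  then have c: "0 < c"
    using a by (simp add: zero_less_mult_iff)
  have le: "pvar p \<Omega> v \<le> ennreal (a * v x)" if "x \<in> \<Omega>" for x
    using v that by (simp add: cone_def var_bound_iff_pvar[OF p])
  then have "pvar p \<Omega> v < \<infinity>"
    using x0 by (metis ennreal_less_top infinity_ennreal_def le_less_trans)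
  then have B: "var_bound p \<Omega> v B"
    by (simp add: var_bound_iff_pvar[OF p] B_def)
  have "B / a \<le> c"
    unfolding c_def
  proof (rule cINF_greatest[OF ne])
    fix x assume x: "x \<in> \<Omega>"
    then have "B \<le> a * v x"
      unfolding B_def using a cone_pos[OF v x] by (intro enn2real_leI le) auto
    then show "B / a \<le> v x"
      using a by (simp add: divide_le_eq mult.commute)
  qed
  then have "var_bound p \<Omega> v (a * c)"
    using a by (intro var_bound_mono[OF p B]) (simp add: divide_le_eq mult.commute)
  then show ?thesis
    using that[of c] c upper bdd by (auto simp: c_def intro: cINF_lower)
qed

lemma var_bound_weight_mult:
  assumes "0 < c" "\<And>x. x \<in> \<Omega> \<Longrightarrow> c \<le> v x" "\<And>x. x \<in> \<Omega> \<Longrightarrow> v x \<le> (1 + a) * c" "var_bound p \<Omega> v (a * c)"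
  shows "var_bound p \<Omega> (\<lambda>x. exp (\<phi> x) * v x) ((M * a + V * (1 + a)) * c)"
proof (rule var_bound_combine[OF p _ _ assms(4) weight_var])
  show "0 \<le> M" "0 \<le> (1 + a) * c"
    using M_pos a assms(1) by auto
  fix x y assume xy: "x \<in> \<Omega>" "y \<in> \<Omega>"
  show "\<bar>exp (\<phi> x) * v x - exp (\<phi> y) * v y\<bar> \<le> M * \<bar>v x - v y\<bar> + (1 + a) * c * \<bar>exp (\<phi> x) - exp (\<phi> y)\<bar>"
    using assms(1) assms(2,3)[of y] weight(2) xy by (intro abs_mult_diff_le) auto
qed (simp add: algebra_simps)

lemma L_in_cone:
  assumes "0 < c" "\<And>x. x \<in> \<Omega> \<Longrightarrow> c \<le> v x" "\<And>x. x \<in> \<Omega> \<Longrightarrow> v x \<le> (1 + a) * c" "var_bound p \<Omega> v (a * c)"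
  shows "\<And>x. x \<in> \<Omega> \<Longrightarrow> m * c \<le> L v x" "var_bound p \<Omega> (L v) (a * (m * c))"
proof -
  show "m * c \<le> L v x" if "x \<in> \<Omega>" for x
    using that assms by (intro L_lower) auto
  have "\<theta> * ((M * a + V * (1 + a)) * c) \<le> a * (m * c)"
    using mult_right_mono[OF invariance, of c] assms(1) by (simp add: mult_ac)
  then show "var_bound p \<Omega> (L v) (a * (m * c))"
    using var_bound_mono[OF p var_bound_L[OF var_bound_weight_mult[OF assms]]] by blast
qed

lemma cone_L:
  assumes "cone v"
  shows "cone (L v)"
proof -
  obtain c where c: "0 < c" "\<And>x. x \<in> \<Omega> \<Longrightarrow> c \<le> v x" "\<And>x. x \<in> \<Omega> \<Longrightarrow> v x \<le> (1 + a) * c"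
    "var_bound p \<Omega> v (a * c)"
    using cone_inf[OF assms] by metis
  show ?thesis
    unfolding cone_def
  proof (intro ballI conjI)
    fix x assume x: "x \<in> \<Omega>"
    show "0 < L v x"
      using L_in_cone(1)[OF c x] m c(1) by (meson mult_pos_pos order_less_le_trans)
    show "var_bound p \<Omega> (L v) (a * L v x)"
      using a L_in_cone(1)[OF c x] by (intro var_bound_mono[OF p L_in_cone(2)[OF c]]) auto
  qed
qed

lemma L_pos: "cone v \<Longrightarrow> x \<in> \<Omega> \<Longrightarrow> 0 < L v x"
  using cone_L cone_pos by blast

text \<open>The quotient \<open>L (v f) / L v\<close> is a weighted average of values of
  \<open>f\<close> with positive weights, so it stays in every interval around \<open>t\<close> that
  contains the values of \<open>f\<close>.\<close>

lemma L_quotient_range: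
  assumes v: "cone v" and f: "\<And>y. y \<in> \<Omega> \<Longrightarrow> \<bar>f y - t\<bar> \<le> D" and x: "x \<in> \<Omega>"
  shows "\<bar>L (\<lambda>y. v y * (f y - t)) x\<bar> \<le> D * L v x"
    and "L (\<lambda>y. v y * (f y - t)) x = L (\<lambda>y. v y * f y) x - t * L v x"
    and "\<bar>L (\<lambda>y. v y * f y) x / L v x - t\<bar> \<le> D"
proof -
  have "L (\<lambda>y. v y * (f y - t)) x \<le> L (\<lambda>y. D * v y) x"
    "L (\<lambda>y. (- D) * v y) x \<le> L (\<lambda>y. v y * (f y - t)) x"
  proof (rule_tac [!] L_mono)
    fix y assume y: "y \<in> \<Omega>"
    have "\<bar>v y * (f y - t)\<bar> \<le> v y * D"
      using f[OF y] cone_pos[OF v y] by (simp add: abs_mult)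
    then show "v y * (f y - t) \<le> D * v y" "(- D) * v y \<le> v y * (f y - t)"
      by (auto simp: abs_le_iff mult.commute)
  qed
  then show le: "\<bar>L (\<lambda>y. v y * (f y - t)) x\<bar> \<le> D * L v x"
    unfolding L_scale_pointwise by linarith
  have "(\<lambda>y. v y * (f y - t)) = (\<lambda>y. v y * f y) + (- t) *\<^sub>R v"
    by (auto simp: scaleR_fun_def algebra_simps)
  then show eq: "L (\<lambda>y. v y * (f y - t)) x = L (\<lambda>y. v y * f y) x - t * L v x"
    by (simp only: L_add L_scale) (simp add: scaleR_fun_def)
  have "L (\<lambda>y. v y * f y) x / L v x - t = L (\<lambda>y. v y * (f y - t)) x / L v x"
    using L_pos[OF v x] by (simp add: eq diff_divide_distrib)
  then show "\<bar>L (\<lambda>y. v y * f y) x / L v x - t\<bar> \<le> D"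
    using le L_pos[OF v x] by (simp add: divide_le_eq)
qed

text \<open>Subtracting the constant \<open>f x0\<close> from \<open>f\<close> subtracts the same constant from the quotient, so \<open>f\<close> may be
  assumed bounded by its variation.\<close>

lemma L_quotient_contraction:
  assumes v: "cone v" and f: "var_bound p \<Omega> f B"
  shows "var_bound p \<Omega> (\<lambda>x. L (\<lambda>y. v y * f y) x / L v x) (\<kappa> * B)"
proof -
  obtain c where c: "0 < c" "\<And>x. x \<in> \<Omega> \<Longrightarrow> c \<le> v x" "\<And>x. x \<in> \<Omega> \<Longrightarrow> v x \<le> (1 + a) * c"
    "var_bound p \<Omega> v (a * c)"
    using cone_inf[OF v] by metis
  obtain x0 where x0: "x0 \<in> \<Omega>"
    using ne by auto
  have B: "0 \<le> B"
    using f by (rule var_bound_nonneg)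
  have osc: "\<bar>f y - f x0\<bar> \<le> B" if "y \<in> \<Omega>" for y
    using var_bound_osc[OF p f that x0] .
  define h where "h = L (\<lambda>y. v y * (f y - f x0))"
  \<comment> \<open>The weight times \<open>v\<close> is treated as a single factor, so that
    \<open>invariance\<close> can later absorb its variation.\<close>
  have "var_bound p \<Omega> (\<lambda>x. exp (\<phi> x) * (v x * (f x - f x0)))
      (M * ((1 + a) * c) * B + B * ((M * a + V * (1 + a)) * c))"
  proof (rule var_bound_combine[OF p _ B f var_bound_weight_mult[OF c]])
    show "0 \<le> M * ((1 + a) * c)"
      using M_pos a c(1) by simp
    fix x y assume xy: "x \<in> \<Omega>" "y \<in> \<Omega>"
    have "\<bar>exp (\<phi> x) * v x\<bar> \<le> M * ((1 + a) * c)"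
      unfolding abs_mult using weight[OF xy(1)] cone_pos[OF v xy(1)] c(3)[OF xy(1)] M_pos
      by (intro mult_mono) auto
    from abs_mult_diff_le[OF this osc[OF xy(2)], of "f x - f x0"  "exp (\<phi> y) * v y"]
    show "\<bar>exp (\<phi> x) * (v x * (f x - f x0)) - exp (\<phi> y) * (v y * (f y - f x0))\<bar>
        \<le> M * ((1 + a) * c) * \<bar>f x - f y\<bar> + B * \<bar>exp (\<phi> x) * v x - exp (\<phi> y) * v y\<bar>"
      by (simp add: mult.assoc)
  qed auto
  then have h: "var_bound p \<Omega> h (\<theta> * (M * ((1 + a) * c) * B + B * ((M * a + V * (1 + a)) * c)))"
    unfolding h_def by (rule var_bound_L)
  have mc: "0 < m * c"
    using m c(1) by simp
  have hw: "\<bar>h x\<bar> \<le> B * L v x" "L (\<lambda>y. v y * f y) x / L v x = h x / L v x + f x0" if "x \<in> \<Omega>" for x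
    using L_quotient_range(1,2)[OF v osc that] L_pos[OF v that] by (auto simp: h_def diff_divide_distrib)
  show ?thesis
  proof (rule var_bound_combine[OF p _ _ h L_in_cone(2)[OF c]])
    show "0 \<le> 1 / (m * c)" "0 \<le> B / (m * c)"
      using mc B by simp_all
    fix x y assume xy: "x \<in> \<Omega>" "y \<in> \<Omega>"
    show "\<bar>L (\<lambda>y. v y * f y) x / L v x - L (\<lambda>y. v y * f y) y / L v y\<bar>
        \<le> 1 / (m * c) * \<bar>h x - h y\<bar> + B / (m * c) * \<bar>L v x - L v y\<bar>"
      using abs_divide_diff_le[OF mc L_in_cone(1)[OF c xy(1)] L_in_cone(1)[OF c xy(2)] hw(1)[OF xy(2)], of "h x"]
      by (simp add: hw(2) xy)
  next
    \<comment> \<open>The three summands come from the variation of \<open>f\<close>, of the weight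
      times \<open>v\<close>, and of the denominator \<open>L v\<close>. By
      \<open>invariance\<close> the second is at most \<open>a\<close>, which explains the
      \<open>2 * a\<close> in \<kappa>.\<close>
    have "1 / (m * c) * (\<theta> * (M * ((1 + a) * c) * B + B * ((M * a + V * (1 + a)) * c))) + B / (m * c) * (a * (m * c))
        = (\<theta> * (M / m) * (1 + a) + \<theta> * (M * a + V * (1 + a)) / m + a) * B"
      using m c(1) by (simp add: divide_simps) (simp add: algebra_simps)
    also have "\<dots> \<le> (\<theta> * (M / m) * (1 + a) + a + a) * B"
      using invariance m B by (intro mult_right_mono[OF add_right_mono[OF add_left_mono]]) (auto simp: divide_le_eq)
    also have "\<dots> = \<kappa> * B"
      by (simp add: \<kappa>)
    finally show "1 / (m * c) * (\<theta> * (M * ((1 + a) * c) * B + B * ((M * a + V * (1 + a)) * c))) + B / (m * c) * (a * (m * c))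
        \<le> \<kappa> * B"
      .
  qed
qed

text \<open>Normalising \<open>f n\<close> at \<open>x0\<close> gives \<open>v n\<close>, with
  \<open>v (Suc n) / v n = r n / r n x0\<close>. This ratio tends to \<open>1\<close> geometrically
  because the variation of \<open>r n\<close> does, so \<open>v n\<close> converges pointwise, and
  the cone condition survives in the limit.\<close>

lemma eigenfunction:
  obtains u lam where "0 < lam" "cone u" "u \<in> X" "L u = lam *\<^sub>R u"
proof -
  obtain x0 where x0: "x0 \<in> \<Omega>"
    using ne by auto
  \<comment> \<open>The indicator is the constant function \<open>1\<close> on \<Omega>, extended by
    zero.\<close>
  define f where "f n = (L ^^ n) (indicat_real \<Omega>)" for n
  have fSuc: "f (Suc n) = L (f n)" for n
    by (simp add: f_def)
  have f: "cone (f n)" for n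
  proof (induction n)
    case 0
    show ?case
      using a by (auto simp: cone_def f_def intro!: var_bound_const[of _ _ 1])
  next
    case (Suc n)
    then show ?case
      by (simp add: fSuc cone_L)
  qed
  have fpos: "0 < f n x" if "x \<in> \<Omega>" for n x
    using cone_pos[OF f that] .
  \<comment> \<open>\<open>r (Suc n)\<close> is the normalised image of \<open>r n\<close> with respect to \<open>f n\<close>, so its variation decays.\<close>
  define r where "r n x = f (Suc n) x / f n x" for n x
  define B where "B = a * f 1 x0"
  have r: "var_bound p \<Omega> (r n) (\<kappa> ^ n * B)" for n
  proof (induction n)
    case 0
    have "var_bound p \<Omega> (f 1) B"
      using f[of 1] x0 by (simp add: cone_def B_def)
    then have "var_bound p \<Omega> (r 0) B"
      by (rule var_bound_cong[OF p]) (simp add: r_def f_def)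
    then show ?case
      by simp
  next
    case (Suc n)
    have "L (\<lambda>y. f n y * r n y) = L (f (Suc n))"
      using fpos[of _ n] by (intro L_cong) (auto simp: r_def less_imp_neq[symmetric])
    then show ?case
      using L_quotient_contraction[OF f Suc.IH, of n] by (simp add: r_def[abs_def] fSuc mult.assoc)
  qed
  define v where "v n x = f n x / f n x0" for n x
  have v_scale: "v n = (\<lambda>x. (1 / f n x0) * f n x)" for n
    by (simp add: v_def[abs_def])
  have v: "0 < v n x" "v n x \<le> 1 + a" "1 / (1 + a) \<le> v n x" "var_bound p \<Omega> (v n) (a * v n x)"
    if x: "x \<in> \<Omega>" for n x
  proof -
    show "0 < v n x" "v n x \<le> 1 + a" "1 / (1 + a) \<le> v n x"
      using fpos[OF x, of n] fpos[OF x0, of n] cone_compare[OF f x x0, of n] cone_compare[OF f x0 x, of n] a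
      by (auto simp: v_def field_simps)
    have "var_bound p \<Omega> (f n) (a * f n x)"
      using f[of n] x by (simp add: cone_def)
    from var_bound_scale[OF p _ this, of "1 / f n x0"]
    show "var_bound p \<Omega> (v n) (a * v n x)"
      using fpos[OF x0, of n] by (simp add: v_def diff_divide_distrib[symmetric])
  qed
  \<comment> \<open>A lower bound uniform in \<open>n\<close>, needed to divide by
    \<open>r n x0\<close>: on \<Omega>, \<open>f n\<close> is at least
    \<open>f n x0 / (1 + a)\<close>, and \<open>L\<close> costs at most the factor
    \<open>m\<close>.\<close>
  have r_lower: "m / (1 + a) \<le> r n x0" for n
  proof -
    have "m * (f n x0 / (1 + a)) \<le> f (Suc n) x0"
      unfolding fSuc using cone_compare[OF f x0, of _ n] fpos[OF x0, of n] a
      by (intro L_lower[OF x0]) (auto simp: field_simps)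
    then show ?thesis
      using fpos[OF x0, of n] a by (simp add: r_def field_simps)
  qed
  have Lv: "L (v n) x = v (Suc n) x * r n x0" for n x
    using fpos[OF x0, of "Suc n"] fpos[OF x0, of n]
    unfolding v_scale L_scale_pointwise by (simp add: r_def fSuc)
  have "convergent (\<lambda>n. v n x)" if x: "x \<in> \<Omega>" for x
  proof (rule convergent_geometric_increments)
    fix n
    have rpos: "0 < m / (1 + a)"
      using m a by simp
    then have rpos': "0 < r n x0"
      using r_lower[of n] by linarith
    have "v (Suc n) x = v n x * (r n x / r n x0)"
      using fpos[OF x0, of "Suc n"] fpos[OF x0, of n] fpos[OF x, of n] by (simp add: v_def r_def)
    then have "v (Suc n) x - v n x = v n x * ((r n x - r n x0) / r n x0)"
      using rpos' by (simp add: field_simps)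
    then have "\<bar>v (Suc n) x - v n x\<bar> = v n x * (\<bar>r n x - r n x0\<bar> / r n x0)"
      using v(1)[OF x, of n] rpos' by (simp add: abs_mult)
    also have "\<dots> \<le> (1 + a) * ((\<kappa> ^ n * B) / (m / (1 + a)))"
      using v(1,2)[OF x, of n] var_bound_osc[OF p r x x0, of n] r_lower[of n] rpos rpos'
      by (intro mult_mono frac_le) auto
    finally show "\<bar>v (Suc n) x - v n x\<bar> \<le> ((1 + a) * B / (m / (1 + a))) * \<kappa> ^ n"
      by (simp add: mult_ac)
  qed (use \<kappa>(2) \<kappa>_pos in auto)
  then have lim: "(\<lambda>n. v n x) \<longlonglongrightarrow> lim (\<lambda>n. v n x)" if "x \<in> \<Omega>" for x
    using that by (simp add: convergent_LIMSEQ_iff)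
  define u where "u x = (if x \<in> \<Omega> then lim (\<lambda>n. v n x) else 0)" for x
  have u: "(\<lambda>n. v n x) \<longlonglongrightarrow> u x" if "x \<in> \<Omega>" for x
    using lim[OF that] that by (simp add: u_def)
  have cone_u: "cone u"
    unfolding cone_def
  proof (intro ballI conjI)
    fix x assume x: "x \<in> \<Omega>"
    have "1 / (1 + a) \<le> u x"
      using v(3)[OF x] by (intro LIMSEQ_le_const[OF u[OF x]]) auto
    then show "0 < u x"
      using a by (meson divide_pos_pos add_pos_pos zero_less_one order_less_le_trans)
    show "var_bound p \<Omega> u (a * u x)"
      by (rule var_bound_tendsto[OF p v(4)[OF x] u]) (auto intro!: tendsto_mult u x)
  qed
  define lam where "lam = L u x0"
  \<comment> \<open>At each point \<open>L\<close> is a finite sum of values, so pointwise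
    convergence is enough.\<close>
  have L_lim: "(\<lambda>n. L (v n) x) \<longlonglongrightarrow> L u x" if "x \<in> \<Omega>" for x
    unfolding L_eq[OF that] using k
    by (intro tendsto_divide tendsto_sum tendsto_mult tendsto_const u branch_in that) auto
  have "v n x0 = 1" for n
    using fpos[OF x0, of n] by (simp add: v_def)
  then have "(\<lambda>n. r n x0) \<longlonglongrightarrow> lam"
    using L_lim[OF x0] by (simp add: Lv lam_def)
  \<comment> \<open>Both sides of \<open>Lv\<close> have limits: the left tends to
    \<open>L u x\<close>, the right to \<open>u x * lam\<close>. Uniqueness of limits is the
    eigenvalue equation.\<close>
  then have "(\<lambda>n. L (v n) x) \<longlonglongrightarrow> u x * lam" if "x \<in> \<Omega>" for x
    unfolding Lv by (intro tendsto_mult LIMSEQ_Suc u that)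
  then have "L u x = u x * lam" if "x \<in> \<Omega>" for x
    using L_lim[OF that] that LIMSEQ_unique by blast
  then have "L u = lam *\<^sub>R u"
    by (intro ext) (auto simp: scaleR_fun_def u_def L_outside)
  moreover have "u \<in> X"
    using cone_u x0 by (auto simp: BV_iff[OF p] u_def cone_def)
  moreover have "0 < lam"
    unfolding lam_def using L_pos[OF cone_u x0] .
  ultimately show ?thesis
    using that cone_u by blast
qed

section \<open>Boundedness of the operator and its spectral gap\<close>

lemma bounded_linear_L: "bounded_linear_on X N L"
  unfolding bounded_linear_on_def
proof (intro conjI ballI allI)
  have L: "L f \<in> X \<and> N (L f) \<le> (M + \<theta> * (M + V)) * N f" if f: "f \<in> X" for f
  proof -
    note * = BV_norm_bounds[OF p ne f]
    have "var_bound p \<Omega> (\<lambda>x. exp (\<phi> x) * f x) ((M + V) * N f)"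
      using weight *(1) M_pos
      by (intro var_bound_combine[OF p _ _ *(2) weight_var, of M "N f"] abs_mult_diff_le *(3))
        (auto simp: algebra_simps)
    then have var: "var_bound p \<Omega> (L f) (\<theta> * ((M + V) * N f))"
      by (rule var_bound_L)
    have "N (L f) \<le> M * N f + \<theta> * ((M + V) * N f)"
      using *(1) by (intro BV_norm_le[OF p ne L_bounded var]) auto
    then show ?thesis
      using var L_outside by (auto simp: BV_iff[OF p] algebra_simps)
  qed
  then show "L ` X \<subseteq> X" "\<exists>K. \<forall>f\<in>X. N (L f) \<le> K * N f"
    by blast+
qed (simp_all add: L_add L_scale)

text \<open>By \<open>FSuc\<close>, \<open>F (Suc n) f\<close> is the normalised operator for
  \<open>v = u\<close> applied to \<open>F n f\<close>. The variation of \<open>F n f\<close>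
  therefore decays like \<open>\<kappa> ^ n\<close>, and the limit \<open>\<nu> f\<close> does not
  depend on the point. The rate in \<open>F_\<nu>\<close> yields the bound on \<nu> at
  \<open>n = 0\<close> and the decay on its kernel.\<close>

lemma spectral_gap: "has_spectral_gap X N L"
proof -
  obtain x0 where x0: "x0 \<in> \<Omega>"
    using ne by auto
  obtain u lam where lam: "0 < lam" and u: "cone u" "u \<in> X" "L u = lam *\<^sub>R u"
    using eigenfunction by metis
  obtain c where c: "0 < c" "\<And>x. x \<in> \<Omega> \<Longrightarrow> c \<le> u x" "\<And>x. x \<in> \<Omega> \<Longrightarrow> u x \<le> (1 + a) * c"
    "var_bound p \<Omega> u (a * c)"
    using cone_inf[OF u(1)] by metis
  have upos: "0 < u x" if "x \<in> \<Omega>" for x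
    using cone_pos[OF u(1) that] .
  have Lu: "L u x = lam * u x" for x
    using u(3) by (simp add: scaleR_fun_def)
  define F where "F n f x = (L ^^ n) f x / (lam ^ n * u x)" for n f x
  \<comment> \<open>The quotient rule for \<open>f / u\<close>, with both the supremum and the
    variation of \<open>f\<close> bounded by \<open>N f\<close>, gives
    \<open>1 / c + a / c\<close>.\<close>
  define K where "K = (1 + a) / c"
  have K: "0 < K"
    using a c(1) by (simp add: K_def)
  have FSuc: "F (Suc n) f x = L (\<lambda>y. u y * F n f y) x / L u x" for n f x
  proof -
    have "L (\<lambda>y. u y * F n f y) = L (\<lambda>y. (1 / lam ^ n) * (L ^^ n) f y)"
      using upos by (intro L_cong) (auto simp: F_def less_imp_neq[symmetric])
    then have "L (\<lambda>y. u y * F n f y) x = (1 / lam ^ n) * L ((L ^^ n) f) x"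
      by (simp only: L_scale_pointwise)
    then show ?thesis
      by (simp add: Lu F_def)
  qed
  have F_var: "var_bound p \<Omega> (F n f) (\<kappa> ^ n * (K * N f))" if f: "f \<in> X" for n f
  proof (induction n)
    case 0
    note * = BV_norm_bounds[OF p ne f]
    have "var_bound p \<Omega> (\<lambda>x. f x / u x) (K * N f)"
    proof (rule var_bound_combine[OF p _ _ *(2) c(4)])
      show "0 \<le> 1 / c" "0 \<le> (N f / c) / c"
        using c(1) *(3) by simp_all
      fix x y assume xy: "x \<in> \<Omega>" "y \<in> \<Omega>"
      have "\<bar>f y\<bar> \<le> N f / c * u y"
      proof -
        have "N f * c \<le> N f * u y"
          using c(2)[OF xy(2)] *(3) by (rule mult_left_mono)
        then have "N f \<le> N f / c * u y"
          using c(1) by (simp add: field_simps)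
        then show ?thesis
          using *(1)[OF xy(2)] by linarith
      qed
      from abs_divide_diff_le[OF c(1) c(2)[OF xy(1)] c(2)[OF xy(2)] this]
      show "\<bar>f x / u x - f y / u y\<bar> \<le> 1 / c * \<bar>f x - f y\<bar> + N f / c / c * \<bar>u x - u y\<bar>" .
    next
      show "1 / c * N f + N f / c / c * (a * c) \<le> K * N f"
        using c(1) by (simp add: K_def field_simps)
    qed
    then show ?case
      by (simp add: F_def[abs_def])
  next
    case (Suc n)
    have "F (Suc n) f = (\<lambda>x. L (\<lambda>y. u y * F n f y) x / L u x)"
      by (rule ext) (rule FSuc)
    then show ?case
      using L_quotient_contraction[OF u(1) Suc] by (simp add: mult.assoc)
  qed
  \<comment> \<open>Being averages, all later iterates stay within the distance from
    \<open>F n f x\<close> that holds at time \<open>n\<close>. The case \<open>l = 1\<close> bounds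
    the increments at \<open>x0\<close>.\<close>
  have F_range: "\<bar>F (n + l) f y - F n f x\<bar> \<le> \<kappa> ^ n * (K * N f)" if "f \<in> X" "x \<in> \<Omega>" "y \<in> \<Omega>" for f n l x y
    using that(3)
  proof (induction l arbitrary: y)
    case 0
    then show ?case
      using var_bound_osc[OF p F_var[OF that(1)]] that(2) by simp
  next
    case (Suc l)
    then show ?case
      using L_quotient_range(3)[OF u(1), of "F (n + l) f" "F n f x"] by (simp add: FSuc)
  qed
  have "convergent (\<lambda>n. F n f x0)" if "f \<in> X" for f
  proof (rule convergent_geometric_increments)
    show "\<bar>F (Suc n) f x0 - F n f x0\<bar> \<le> K * N f * \<kappa> ^ n" for n
      using F_range[OF that x0 x0, of n 1] by (simp add: mult.commute)
  qed (use \<kappa>(2) \<kappa>_pos in auto)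
  then have lim: "(\<lambda>n. F n f x0) \<longlonglongrightarrow> lim (\<lambda>n. F n f x0)" if "f \<in> X" for f
    using that by (simp add: convergent_LIMSEQ_iff)
  define \<nu> where "\<nu> f = lim (\<lambda>n. F n f x0)" for f
  have \<nu>: "(\<lambda>n. F n f x0) \<longlonglongrightarrow> \<nu> f" if "f \<in> X" for f
    using lim[OF that] by (simp add: \<nu>_def)
  have \<nu>_eqI: "\<nu> f = l" if "(\<lambda>n. F n f x0) \<longlonglongrightarrow> l" for f l
    using limI[OF that] by (simp add: \<nu>_def)
  have F_\<nu>: "\<bar>\<nu> f - F n f x\<bar> \<le> \<kappa> ^ n * (K * N f)" if f: "f \<in> X" and x: "x \<in> \<Omega>" for f n x
  proof (rule LIMSEQ_le_const2)
    show "(\<lambda>l. \<bar>F (l + n) f x0 - F n f x\<bar>) \<longlonglongrightarrow> \<bar>\<nu> f - F n f x\<bar>"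
      by (intro tendsto_rabs tendsto_diff tendsto_const LIMSEQ_ignore_initial_segment[OF \<nu>[OF f]])
    show "\<exists>M. \<forall>l\<ge>M. \<bar>F (l + n) f x0 - F n f x\<bar> \<le> \<kappa> ^ n * (K * N f)"
      using F_range[OF f x x0, of n] by (simp add: add.commute)
  qed
  show ?thesis
  proof (rule has_spectral_gapI[OF banach_space_on_BV[OF p ne] bounded_linear_L lam u(2,3)])
    have "(L ^^ n) u = lam ^ n *\<^sub>R u" for n
      by (induction n) (simp_all add: L_scale u(3))
    then have "F n u x0 = 1" for n
      using upos[OF x0] lam by (simp add: F_def scaleR_fun_def)
    then show "\<nu> u = 1"
      by (intro \<nu>_eqI) simp
    show "\<nu> (f + h) = \<nu> f + \<nu> h" if "f \<in> X" "h \<in> X" for f h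
    proof (rule \<nu>_eqI)
      have "F n (f + h) x0 = F n f x0 + F n h x0" for n
        by (simp add: F_def L_funpow_add add_divide_distrib)
      then show "(\<lambda>n. F n (f + h) x0) \<longlonglongrightarrow> \<nu> f + \<nu> h"
        using tendsto_add[OF \<nu>[OF that(1)] \<nu>[OF that(2)]] by simp
    qed
    show "\<nu> (d *\<^sub>R f) = d * \<nu> f" if "f \<in> X" for d f
    proof (rule \<nu>_eqI)
      have "F n (d *\<^sub>R f) x0 = d * F n f x0" for n
        unfolding F_def L_funpow_scale by (simp add: scaleR_fun_def)
      then show "(\<lambda>n. F n (d *\<^sub>R f) x0) \<longlonglongrightarrow> d * \<nu> f"
        using tendsto_mult_left[OF \<nu>[OF that], of d] by simp
    qed
    show "\<nu> (L f) = lam * \<nu> f" if "f \<in> X" for f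
    proof (rule \<nu>_eqI)
      have "F n (L f) x0 = lam * F (Suc n) f x0" for n
        using lam by (simp add: F_def funpow_swap1)
      then show "(\<lambda>n. F n (L f) x0) \<longlonglongrightarrow> lam * \<nu> f"
        using tendsto_mult_left[OF LIMSEQ_Suc[OF \<nu>[OF that]], of lam] by simp
    qed
    show "\<bar>\<nu> f\<bar> \<le> (1 / c + K) * N f" if f: "f \<in> X" for f
    proof -
      have "\<bar>F 0 f x0\<bar> = \<bar>f x0\<bar> / u x0"
        using upos[OF x0] by (simp add: F_def)
      also have "\<dots> \<le> N f / c"
        using BV_norm_bounds(1)[OF p ne f x0] c(1) c(2)[OF x0] by (intro frac_le) auto
      finally show ?thesis
        using F_\<nu>[OF f x0, of 0] by (simp add: distrib_right)
    qed
    \<comment> \<open>On \<Omega>, \<open>(L ^^ n) f\<close> is \<open>lam ^ n\<close> times the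
      product of \<open>u\<close> and \<open>F n f\<close>. The first \<open>(1 + a) * c\<close>
      bounds the supremum; the second and \<open>a * c\<close> come from the product rule for the
      variation.\<close>
    show "N ((L ^^ n) f) \<le> (((1 + a) * c + (1 + a) * c + a * c) * K) * lam ^ n * \<kappa> ^ n * N f"
      if f: "f \<in> X" "\<nu> f = 0" for f n
    proof -
      define E where "E = \<kappa> ^ n * (K * N f)"
      have F: "\<bar>F n f x\<bar> \<le> E" if "x \<in> \<Omega>" for x
        using F_\<nu>[OF f(1) that, of n] f(2) by (simp add: E_def)
      have eq: "(L ^^ n) f x = lam ^ n * (u x * F n f x)" if "x \<in> \<Omega>" for x
        using lam upos[OF that] by (simp add: F_def)
      have E: "0 \<le> E"
        using F[OF x0] by linarith
      have ub: "\<bar>u x\<bar> \<le> (1 + a) * c" if "x \<in> \<Omega>" for x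
        using upos[OF that] c(3)[OF that] by simp
      have "var_bound p \<Omega> (\<lambda>x. u x * F n f x) ((1 + a) * c * E + E * (a * c))"
        using a c(1)
        by (intro var_bound_combine[OF p _ E F_var[OF f(1), of n, folded E_def] c(4), of "(1 + a) * c"]
            abs_mult_diff_le F ub) simp_all
      from var_bound_scale[OF p _ this order_refl, of "lam ^ n" "(L ^^ n) f"]
      have var: "var_bound p \<Omega> ((L ^^ n) f) (lam ^ n * ((1 + a) * c * E + E * (a * c)))"
        using lam by (simp add: eq abs_mult right_diff_distrib[symmetric])
      have "\<bar>(L ^^ n) f x\<bar> \<le> lam ^ n * ((1 + a) * c * E)" if "x \<in> \<Omega>" for x
        unfolding eq[OF that] abs_mult using lam a c(1) F[OF that] ub[OF that]
        by (intro mult_mono) auto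
      from BV_norm_le[OF p ne this var]
      show ?thesis
        by (simp add: E_def algebra_simps)
    qed
  qed (use \<kappa>(2) \<kappa>_pos in auto)
qed

end

section \<open>Small potentials\<close>

theorem theorem4p2:
  fixes \<Omega> :: "real set" and T :: "real \<Rightarrow> real" and k :: nat
    and b :: "nat \<Rightarrow> real \<Rightarrow> real" and p :: real and \<phi> :: "real \<Rightarrow> real"
  assumes "compact \<Omega>" and "is_interval \<Omega>" and "\<Omega> \<noteq> {}"
    and "class_V \<Omega> T k b" and "k \<ge> 2"
    and "1 \<le> p"
    and "\<phi> \<in> BV p \<Omega>"
    and "pvar p \<Omega> \<phi> \<le> ennreal (2 / 3 * ln (1 + (real k powr (1 / p) - 1)\<^sup>2 /
           (16 * real k powr (1 / p) * (real k powr (1 / p) + 1))))"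
  shows "has_spectral_gap (BV p \<Omega>) (BV_norm p \<Omega>) (transfer_op \<Omega> k b \<phi>)"
proof -
  define A where "A = real k powr (1 / p)"
  define \<theta> where "\<theta> = real k powr (- 1 / p)"
  \<comment> \<open>With this choice \<open>\<theta> = 1 - 4 * a\<close>, and the conditions of the
    locale reduce to polynomial inequalities in \<open>a\<close>.\<close>
  define a where "a = (1 - \<theta>) / 4"
  \<comment> \<open>In terms of \<open>a = (A - 1) / (4 * A)\<close> this is
    \<open>a\<^sup>2 * A / (A + 1)\<close>, hence at most \<open>a\<^sup>2\<close>.\<close>
  define \<eta> where "\<eta> = (A - 1)\<^sup>2 / (16 * A * (A + 1))"
  define \<beta> where "\<beta> = 2 / 3 * ln (1 + \<eta>)"
  define m where "m = exp (Inf (\<phi> ` \<Omega>))"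
  define M where "M = m * exp \<beta>"
  have A: "1 < A"
    using assms(5,6) by (simp add: A_def)
  have \<theta>A: "\<theta> = 1 / A"
    by (simp add: \<theta>_def A_def powr_minus_divide)
  have \<theta>: "0 < \<theta>" "\<theta> = 1 - 4 * a"
    using A by (simp add: \<theta>A, simp add: a_def diff_divide_distrib)
  have a: "0 < a" "a < 1 / 4"
    using A by (simp_all add: a_def \<theta>A)
  have \<eta>: "0 \<le> \<eta>" "\<eta> \<le> a\<^sup>2"
  proof -
    show "0 \<le> \<eta>"
      using A by (simp add: \<eta>_def)
    have "a\<^sup>2 = (A - 1)\<^sup>2 / (16 * A * A)"
      using A by (simp add: a_def \<theta>A field_simps power2_eq_square)
    then show "\<eta> \<le> a\<^sup>2"
      unfolding \<eta>_def using A by (auto intro!: divide_left_mono)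
  qed
  have a2: "a\<^sup>2 \<le> 1 / 16"
    using a power_mono[of a "1/4" 2] by (simp add: power2_eq_square)
  have \<beta>: "0 \<le> \<beta>" "\<beta> \<le> 2 / 3 * \<eta>" "exp \<beta> \<le> 1 + \<eta>"
  proof -
    show "0 \<le> \<beta>" "\<beta> \<le> 2 / 3 * \<eta>"
      using \<eta>(1) ln_add_one_self_le_self[OF \<eta>(1)] by (simp_all add: \<beta>_def)
    have "\<beta> \<le> ln (1 + \<eta>)"
      using \<eta>(1) by (simp add: \<beta>_def)
    then show "exp \<beta> \<le> 1 + \<eta>"
      using \<eta>(1) by (metis add_pos_nonneg exp_le_cancel_iff exp_ln zero_less_one)
  qed
  have var: "var_bound p \<Omega> \<phi> \<beta>"
    using assms(8) \<beta>(1) by (simp add: var_bound_iff_pvar[OF assms(6)] \<beta>_def \<eta>_def A_def)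
  obtain x0 where x0: "x0 \<in> \<Omega>"
    using assms(3) by auto
  have osc: "\<phi> x \<le> \<beta> + \<phi> y" if "x \<in> \<Omega>" "y \<in> \<Omega>" for x y
    using var_bound_osc[OF assms(6) var that] by linarith
  have bdd: "bdd_below (\<phi> ` \<Omega>)"
    using osc[OF x0] by (intro bdd_belowI2[of _ "\<phi> x0 - \<beta>"]) (auto simp: algebra_simps)
  have m: "m \<le> exp (\<phi> x)" and M: "exp (\<phi> x) \<le> M" if "x \<in> \<Omega>" for x
  proof -
    show "m \<le> exp (\<phi> x)"
      using bdd that by (simp add: m_def cINF_lower)
    have "\<phi> x - \<beta> \<le> Inf (\<phi> ` \<Omega>)"
      using osc[OF that] assms(3) by (intro cINF_greatest) (auto simp: algebra_simps)
    then show "exp (\<phi> x) \<le> M"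
      by (simp add: M_def m_def exp_add[symmetric])
  qed
  have weight_var: "var_bound p \<Omega> (\<lambda>x. exp (\<phi> x)) (M * \<beta>)"
  proof (rule var_bound_scale[OF assms(6) _ var order_refl])
    show M0: "0 \<le> M"
      by (simp add: M_def m_def)
    \<comment> \<open>Convexity of \<open>exp\<close>; as its values on the range of \<phi> are at
      most \<open>M\<close>, it is \<open>M\<close>-Lipschitz there.\<close>
    have lip: "exp s - exp t \<le> exp s * (s - t)" for s t :: real
      using exp_ge_add_one_self[of "t - s"] mult_left_mono[of "1 + (t - s)" "exp (t - s)" "exp s"]
      by (simp add: exp_add[symmetric] algebra_simps)
    fix x y assume xy: "x \<in> \<Omega>" "y \<in> \<Omega>"
    have *: "exp (\<phi> x) - exp (\<phi> y) \<le> M * \<bar>\<phi> x - \<phi> y\<bar>" if "x \<in> \<Omega>" for x y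
    proof -
      have "exp (\<phi> x) * (\<phi> x - \<phi> y) \<le> M * \<bar>\<phi> x - \<phi> y\<bar>"
        using M[OF that] by (intro order_trans[OF mult_left_mono mult_right_mono]) auto
      then show ?thesis
        using lip[of "\<phi> x" "\<phi> y"] by linarith
    qed
    show "\<bar>exp (\<phi> x) - exp (\<phi> y)\<bar> \<le> M * \<bar>\<phi> x - \<phi> y\<bar>"
      using *[OF xy(1), of y] *[OF xy(2), of x] by (simp add: abs_le_iff abs_minus_commute)
  qed
  have m0: "0 < m"
    by (simp add: m_def)
  have M_le: "M \<le> m * (1 + a\<^sup>2)"
    using \<beta>(3) \<eta>(2) m0 by (simp add: M_def)
  have V_le: "M * \<beta> \<le> m * a\<^sup>2"
  proof -
    \<comment> \<open>The factor \<open>2 / 3\<close> in the hypothesis absorbs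
      \<open>exp \<beta>\<close>: the constant is \<open>17 / 16 * 2 / 3 = 17 / 24\<close>, below
      \<open>1\<close>.\<close>
    have "exp \<beta> * \<beta> \<le> (1 + 1 / 16) * (2 / 3 * a\<^sup>2)"
      using \<beta> \<eta> a2 by (intro mult_mono) auto
    also have "\<dots> \<le> a\<^sup>2"
      by simp
    finally show ?thesis
      using m0 by (simp add: M_def mult.assoc)
  qed
  have "\<theta> * (M * a + M * \<beta> * (1 + a)) \<le> \<theta> * (m * (1 + a\<^sup>2) * a + m * a\<^sup>2 * (1 + a))"
    using M_le V_le \<theta>(1) a by (intro mult_left_mono add_mono mult_right_mono) auto
  \<comment> \<open>After substituting \<open>\<theta> = 1 - 4 * a\<close>, every nonconstant
    coefficient in the bracket is negative.\<close>
  also have "\<dots> = a * m * (1 - 3 * a - 2 * a ^ 2 - 8 * a ^ 3)"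
    unfolding \<theta>(2) by (simp add: algebra_simps power2_eq_square power3_eq_cube)
  also have "\<dots> \<le> a * m * 1"
  proof (rule mult_left_mono)
    show "1 - 3 * a - 2 * a ^ 2 - 8 * a ^ 3 \<le> 1"
      using a(1) zero_less_power[OF a(1), of 2] zero_less_power[OF a(1), of 3] by linarith
  qed (use a m0 in simp)
  finally have invariance: "\<theta> * (M * a + M * \<beta> * (1 + a)) \<le> a * m"
    by simp
  have "\<theta> * (M / m) * (1 + a) + 2 * a \<le> \<theta> * (1 + a\<^sup>2) * (1 + a) + 2 * a"
    using M_le m0 \<theta>(1) a by (intro add_mono mult_right_mono mult_left_mono) (auto simp: divide_le_eq mult.commute)
  \<comment> \<open>The linear coefficient is \<open>1 - 4 + 2 = -1\<close>: the \<open>4\<close> in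
    the definition of \<open>a\<close> outweighs the factor \<open>1 + a\<close> and the summand
    \<open>2 * a\<close>.\<close>
  also have "\<dots> = 1 - a - 3 * a ^ 2 - 3 * a ^ 3 - 4 * a ^ 4"
    unfolding \<theta>(2) by (simp add: algebra_simps power2_eq_square power3_eq_cube power4_eq_xxxx)
  also have "\<dots> < 1"
    using a(1) zero_less_power[OF a(1), of 2] zero_less_power[OF a(1), of 3] zero_less_power[OF a(1), of 4]
    by linarith
  finally have \<kappa>: "\<theta> * (M / m) * (1 + a) + 2 * a < 1" .
  interpret bv_transfer \<Omega> T k b p \<phi> m M "M * \<beta>" a \<theta> "\<theta> * (M / m) * (1 + a) + 2 * a"
    using assms m M m0 weight_var a(1) invariance \<kappa> by unfold_locales (auto simp: \<theta>_def)
  show ?thesis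
    by (rule spectral_gap)
qed

end
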